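(* Fix $s\in[0,\infty)$. There exists a constant $\Theta_s$ (depending only on $s$) such that for any positive integer $d$ and any upper semi-continuous log-concave function $f\colon\mathbb{R}^d\to[0,\infty)$ of finite positive integral, the following inequality holds: $$\left(\frac{\int_{\mathbb{R}^d}{}^{(s)}L_f}{\int_{\mathbb{R}^d}f}\right)^{1/d}\le\Theta_s\sqrt{d}.$$
   Context: $|\cdot|$ denotes the Euclidean norm. A function $f\colon\mathbb{R}^d\to[0,\infty)$ is log-concave if $f=e^{-\varphi}$ for a convex function $\varphi\colon\mathbb{R}^d\to\mathbb{R}\cup\{+\infty\}$ (with $e^{-\infty}=0$). The relation $f_1\le f_2$ means $f_1(x)\le f_2(x)$ for all $x\in\mathbb{R}^d$. The function $\psi_s\colon[0,\infty)\to[0,\infty)$ is defined by $\psi_0(t)=t$ and, for $s\in(0,\infty)$, $$\psi_s(t)=\frac{s}{2}\left[\sqrt{1+4\left(\tfrac{t}{s}\right)^2}-\ln\left(\frac{1+\sqrt{1+4(t/s)^2}}{2}\right)-1\right].$$ $\mathcal{E}^d[\psi_s]$ is the class of functions on $\mathbb{R}^d$ of the form $x\mapsto\alpha e^{-\psi_s(|A(x-a)|)}$ with $A\in\mathrm{GL}(d)$, $\alpha>0$, $a\in\mathbb{R}^d$. For $s\in[0,\infty)$, the Löwner $s$-function ${}^{(s)}L_f$ of $f$ is the (existing and unique) function $\ell\in\mathcal{E}^d[\psi_s]$ that minimizes $\int_{\mathbb{R}^d}\ell$ subject to $f\le\ell$. *)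

theory Defs
  imports "HOL-Analysis.Analysis" "Jordan_Normal_Form.Matrix"
begin

text \<open>
  The dimension \<open>d\<close> is quantified inside the statement (the constant must not depend on it), so
  it cannot be a type. The space \<open>\<real>\<^sup>d\<close> is the set \<^term>\<open>carrier_vec d\<close> of real vectors of length \<open>d\<close>;
  values of functions outside \<^term>\<open>carrier_vec d\<close> are irrelevant.
\<close>

definition lborel_vec :: "nat \<Rightarrow> real Matrix.vec measure" where
  "lborel_vec d = embed_measure (PiM {..<d} (\<lambda>_. lborel)) (Matrix.vec d)"

definition euclidean_norm :: "real Matrix.vec \<Rightarrow> real" where
  "euclidean_norm v = sqrt (v \<bullet> v)"

definition convex_function :: "nat \<Rightarrow> (real Matrix.vec \<Rightarrow> ereal) \<Rightarrow> bool" where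
  "convex_function d \<phi> \<longleftrightarrow>
     (\<forall>x\<in>carrier_vec d. \<phi> x \<noteq> -\<infinity>) \<and>
     (\<forall>x\<in>carrier_vec d. \<forall>y\<in>carrier_vec d. \<forall>t. 0 < t \<and> t < 1 \<longrightarrow>
        \<phi> ((1 - t) \<cdot>\<^sub>v x + t \<cdot>\<^sub>v y) \<le> ereal (1 - t) * \<phi> x + ereal t * \<phi> y)"

text \<open>\<^const>\<open>real_of_ereal\<close> sends \<open>\<infinity>\<close> to 0, whence the separate case for \<open>e\<close> to the power \<open>-\<infinity>\<close>.\<close>

definition log_concave :: "nat \<Rightarrow> (real Matrix.vec \<Rightarrow> real) \<Rightarrow> bool" where
  "log_concave d f \<longleftrightarrow>
     (\<exists>\<phi>. convex_function d \<phi> \<and>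
        (\<forall>x\<in>carrier_vec d. f x = (if \<phi> x = \<infinity> then 0 else exp (- real_of_ereal (\<phi> x)))))"

definition upper_semicontinuous :: "nat \<Rightarrow> (real Matrix.vec \<Rightarrow> real) \<Rightarrow> bool" where
  "upper_semicontinuous d f \<longleftrightarrow>
     (\<forall>x\<in>carrier_vec d. \<forall>\<epsilon>>0. \<exists>\<delta>>0. \<forall>y\<in>carrier_vec d.
        euclidean_norm (y - x) < \<delta> \<longrightarrow> f y < f x + \<epsilon>)"

definition psi :: "real \<Rightarrow> real \<Rightarrow> real" where
  "psi s t =
     (if s = 0 then t
      else s / 2 * (sqrt (1 + 4 * (t / s)\<^sup>2) - ln ((1 + sqrt (1 + 4 * (t / s)\<^sup>2)) / 2) - 1))"

definition ellipsoidal_functions ::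
    "nat \<Rightarrow> (real \<Rightarrow> real) \<Rightarrow> (real Matrix.vec \<Rightarrow> real) set" where
  "ellipsoidal_functions d \<psi> =
     {g. \<exists>A \<alpha> a. A \<in> carrier_mat d d \<and> invertible_mat A \<and> \<alpha> > 0 \<and> a \<in> carrier_vec d \<and>
        (\<forall>x\<in>carrier_vec d. g x = \<alpha> * exp (- \<psi> (euclidean_norm (A *\<^sub>v (x - a)))))}"

text \<open>
  For \<open>s \<ge> 0\<close>, \<^term>\<open>psi s t\<close> grows linearly up to a logarithmic term, so every member of
  \<^term>\<open>ellipsoidal_functions d (psi s)\<close> is integrable and the integrals below are true integrals,
  not the value 0 that the Bochner integral takes on non-integrable functions.
\<close>

definition is_loewner_function ::
    "nat \<Rightarrow> real \<Rightarrow> (real Matrix.vec \<Rightarrow> real) \<Rightarrow> (real Matrix.vec \<Rightarrow> real) \<Rightarrow> bool" where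
  "is_loewner_function d s f =
     is_arg_min (\<lambda>g. integral\<^sup>L (lborel_vec d) g)
       (\<lambda>g. g \<in> ellipsoidal_functions d (psi s) \<and> (\<forall>x\<in>carrier_vec d. f x \<le> g x))"

text \<open>
  The minimizer is unique as a function on \<^term>\<open>carrier_vec d\<close>. Its values elsewhere are arbitrary,
  so it is selected by \<open>SOME\<close> rather than \<open>THE\<close>.
\<close>

definition loewner_function ::
    "nat \<Rightarrow> real \<Rightarrow> (real Matrix.vec \<Rightarrow> real) \<Rightarrow> real Matrix.vec \<Rightarrow> real" where
  "loewner_function d s f = (SOME g. is_loewner_function d s f g)"

end

theory Submission
  imports Defs "Jordan_Normal_Form.Determinant" "HOL-Real_Asymp.Real_Asymp"
begin

text \<open>
  Since \<open>t / 2 - s / 4 \<le> psi s t \<le> t\<close>, it suffices to majorize \<open>f\<close> by some \<open>\<alpha> exp (- |A (x - y)|)\<close>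
  with \<open>\<alpha> / |det A| \<le> C\<^sup>d \<integral>f\<close>: as \<open>|x|\<^sub>1 \<le> \<surd>d |x|\<close>, Fubini's theorem bounds the
  integral of \<open>exp (- |x| / 2)\<close> by \<open>(4 \<surd>d)\<^sup>d\<close>.

  Let \<open>y\<close> be a near-maximum of \<open>f\<close>, moved to the origin, and let \<open>K\<close> be the level set
  \<open>{f \<ge> exp (- 3 d) sup f}\<close>. Let \<open>D\<close> be the supremum of \<open>|det (x\<^sub>1, \<dots>, x\<^sub>d)|\<close> over points of \<open>K\<close>.
  The simplex spanned by \<open>0, x\<^sub>1, \<dots>, x\<^sub>d\<close> lies in \<open>K\<close>, so \<open>D\<close> is at most
  \<open>d\<^sup>d exp (3 d) \<integral>f / sup f\<close>. Instead of John's theorem, an ellipsoid around \<open>K\<close> of the right volume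
  is built greedily from Gram matrices \<open>\<Sum> x x\<^sup>T\<close> of about \<open>2 d\<close> points of \<open>K\<close>, whose determinants are at
  most \<open>2\<^bsup>n\<^esup> D\<^sup>2\<close> for \<open>n\<close> points. Log-concavity then turns the drop of \<open>f\<close> by \<open>exp (- 3 d)\<close> at
  the boundary of the ellipsoid into exponential decay. A compactness argument shows that the Loewner
  function exists, and its integral is at most that of the majorant.
\<close>

no_notation vec_nth (infixl \<open>$\<close> 90)
no_notation inner (infix \<open>\<bullet>\<close> 70)
hide_const (open) Finite_Cartesian_Product.vec Determinants.det Finite_Cartesian_Product.mat
  Finite_Cartesian_Product.row Finite_Cartesian_Product.column

section \<open>Lebesgue measure on real vectors\<close>

text \<open>Since a \<open>d\<close>-th root is taken at the end, factors of the form
  \<open>c ^ d\<close> are harmless; the danger is \<open>d ^ d\<close>. Such a factor enters when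
  the volume of a simplex is compared with the determinant of its edges. It leaves again through the
  decay rate: the level \<open>exp (- 3 * d)\<close> is so low that log-concavity yields decay of
  rate \<open>d\<close>, not merely of constant rate, in the norm belonging to the ellipsoid. The
  matrix of the majorant is therefore \<open>d\<close> times the matrix of that norm, and its
  determinant puts \<open>d ^ d\<close> into the denominator. In this argument a level such as half
  the supremum would leave a full factor \<open>d\<close> after the root. What survives is the
  \<open>sqrt d\<close> from the integral of the radial profile. An ellipsoid is represented by a
  factor \<open>B\<close> of a Gram matrix, so adding or removing a point is a rank-one update with
  an explicit square root. Existence of a minimizer is part of the argument because
  \<open>loewner_function\<close> is chosen by \<open>SOME\<close>: nothing can be said about its
  integral before some minimizer is known.\<close>

lemma space_lborel_vec [simp]: "space (lborel_vec d) = carrier_vec d"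
proof -
  have 1: "x \<in> vec d ` (\<Pi>\<^sub>E i\<in>{..<d}. UNIV)" if x: "x \<in> carrier_vec d" for x :: "real Matrix.vec"
  proof (rule image_eqI)
    show "x = vec d (restrict (\<lambda>i. x $ i) {..<d})"
      using x by (intro eq_vecI) auto
  qed (rule restrict_PiE[THEN iffD2], blast)
  have 2: "vec d ` (\<Pi>\<^sub>E i\<in>{..<d}. UNIV) \<subseteq> (carrier_vec d :: real Matrix.vec set)"
    by (rule image_subsetI) (rule vec_carrier)
  show ?thesis
    unfolding lborel_vec_def space_embed_measure space_PiM space_lborel space_borel
    by (rule subset_antisym[OF 2 subsetI[OF 1]])
qed

lemma inj_on_vec_PiM: "inj_on (vec d) (space (PiM {..<d} (\<lambda>_. lborel :: real measure)))"
proof (rule inj_onI)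
  fix x y :: "nat \<Rightarrow> real"
  assume *: "x \<in> space (PiM {..<d} (\<lambda>_. lborel))" "y \<in> space (PiM {..<d} (\<lambda>_. lborel))"
    and eq: "vec d x = vec d y"
  have "x i = y i" if "i < d" for i
    using arg_cong[OF eq, of "\<lambda>v. v $ i"] that by simp
  with * show "x = y"
    by (auto simp: space_PiM intro: PiE_ext)
qed

lemma measurable_vec_PiM [measurable]:
  "vec d \<in> measurable (PiM {..<d} (\<lambda>_. lborel)) (lborel_vec d)"
  unfolding lborel_vec_def by (rule measurable_embed_measure2'[OF inj_on_vec_PiM])

lemma measurable_vec_index:
  "i < d \<Longrightarrow> (\<lambda>x. x $ i) \<in> borel_measurable (lborel_vec d)"
  unfolding lborel_vec_def by (rule measurable_embed_measure1) simp

lemma measurable_lborel_vecI: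
  assumes "\<And>w. w \<in> space N \<Longrightarrow> h w \<in> carrier_vec d"
    and "\<And>i. i < d \<Longrightarrow> (\<lambda>w. h w $ i) \<in> borel_measurable N"
  shows "h \<in> measurable N (lborel_vec d)"
proof -
  have "(\<lambda>w. \<lambda>i\<in>{..<d}. h w $ i) \<in> measurable N (PiM {..<d} (\<lambda>_. lborel))"
    by (rule measurable_restrict) (use assms(2) in simp)
  then have "(\<lambda>w. vec d (\<lambda>i\<in>{..<d}. h w $ i)) \<in> measurable N (lborel_vec d)"
    by (rule measurable_compose[OF _ measurable_vec_PiM])
  then show ?thesis
  proof (rule measurable_cong[THEN iffD1, rotated])
    fix w assume "w \<in> space N"
    from assms(1)[OF this] show "vec d (\<lambda>i\<in>{..<d}. h w $ i) = h w"
      by (intro eq_vecI) simp_all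
  qed
qed

lemma nn_integral_lborel_vec:
  "g \<in> borel_measurable (lborel_vec d) \<Longrightarrow>
    (\<integral>\<^sup>+x. g x \<partial>lborel_vec d) = (\<integral>\<^sup>+x. g (vec d x) \<partial>PiM {..<d} (\<lambda>_. lborel))"
  unfolding lborel_vec_def by (rule nn_integral_embed_measure'[OF inj_on_vec_PiM])

definition upd_vec :: "nat \<Rightarrow> real Matrix.vec \<Rightarrow> nat \<Rightarrow> real \<Rightarrow> real Matrix.vec" where
  "upd_vec d x k t = vec d (\<lambda>i. if i = k then t else x $ i)"

text \<open>Fubini isolates coordinate \<open>k\<close>. As \<open>h\<close> does not depend on that
  coordinate, the map is on each line parallel to the axis a one-dimensional affine substitution
  with slope \<open>c\<close>. Translations and row matrices both reduce to this case.\<close>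

lemma nn_integral_affine_coordinate:
  assumes k: "k < d" and c: "c \<noteq> 0"
    and [measurable]: "h \<in> borel_measurable (lborel_vec d)" "g \<in> borel_measurable (lborel_vec d)"
    and h: "\<And>x t. x \<in> carrier_vec d \<Longrightarrow> h (upd_vec d x k t) = h x"
  shows "ennreal \<bar>c\<bar> * (\<integral>\<^sup>+x. g (upd_vec d x k (c * x $ k + h x)) \<partial>lborel_vec d)
    = (\<integral>\<^sup>+x. g x \<partial>lborel_vec d)"
proof -
  let ?P = "\<lambda>I. PiM I (\<lambda>_. lborel :: real measure)"
  interpret product_sigma_finite "\<lambda>_::nat. lborel :: real measure"
    by standard
  define I where "I = {..<d} - {k}"
  have I: "finite I" "k \<notin> I" "{..<d} = insert k I"
    using k by (auto simp: I_def)
  have [measurable]: "(\<lambda>x. upd_vec d x k (c * x $ k + h x)) \<in> measurable (lborel_vec d) (lborel_vec d)"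
  proof (rule measurable_lborel_vecI)
    fix i assume i: "i < d"
    note measurable_vec_index[OF i, measurable] measurable_vec_index[OF k, measurable]
    show "(\<lambda>x. upd_vec d x k (c * x $ k + h x) $ i) \<in> borel_measurable (lborel_vec d)"
      using i by (cases "i = k") (simp_all add: upd_vec_def)
  qed (simp add: upd_vec_def)
  have meas: "(\<lambda>y. x(k := y)) \<in> measurable lborel (?P {..<d})" if "x \<in> space (?P I)" for x
    using measurable_component_update[OF that I(2)] unfolding I(3) .
  have upd: "upd_vec d (vec d (x(k := y))) k t = vec d (x(k := t))" for x y t
    by (intro eq_vecI) (auto simp: upd_vec_def)
  \<comment> \<open>The value 0 is an arbitrary representative; it makes the offset visibly constant
    in the inner integration variable.\<close>
  have hv: "h (vec d (x(k := y))) = h (vec d (x(k := 0)))" for x y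
    using h[of "vec d (x(k := y))" 0] unfolding upd by simp
  have "(\<integral>\<^sup>+x. g x \<partial>lborel_vec d) = (\<integral>\<^sup>+x. g (vec d x) \<partial>?P {..<d})"
    by (rule nn_integral_lborel_vec) simp
  also have "\<dots> = (\<integral>\<^sup>+x. (\<integral>\<^sup>+y. g (vec d (x(k := y))) \<partial>lborel) \<partial>?P I)"
    unfolding I(3) by (rule product_nn_integral_insert[OF I(1,2)]) (unfold I(3)[symmetric], measurable)
  also have "\<dots> = (\<integral>\<^sup>+x. ennreal \<bar>c\<bar> * (\<integral>\<^sup>+y. g (vec d (x(k := h (vec d (x(k := 0))) + c * y))) \<partial>lborel) \<partial>?P I)"
  proof (rule nn_integral_cong)
    fix x assume x: "x \<in> space (?P I)"
    have "(\<lambda>y. g (vec d (x(k := y)))) \<in> borel_measurable borel"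
      using measurable_compose[OF meas[OF x], of "\<lambda>w. g (vec d w)" borel] by simp
    from nn_integral_real_affine[OF this c]
    show "(\<integral>\<^sup>+y. g (vec d (x(k := y))) \<partial>lborel)
        = ennreal \<bar>c\<bar> * (\<integral>\<^sup>+y. g (vec d (x(k := h (vec d (x(k := 0))) + c * y))) \<partial>lborel)" .
  qed
  also have "\<dots> = (\<integral>\<^sup>+x. (\<integral>\<^sup>+y. ennreal \<bar>c\<bar> * g (vec d (x(k := h (vec d (x(k := 0))) + c * y))) \<partial>lborel) \<partial>?P I)"
  proof (intro nn_integral_cong nn_integral_cmult[symmetric])
    fix x assume x: "x \<in> space (?P I)"
    have "(\<lambda>y. g (vec d (x(k := y)))) \<in> borel_measurable borel"
      using measurable_compose[OF meas[OF x], of "\<lambda>w. g (vec d w)" borel] by simp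
    from measurable_compose[OF _ this, of "\<lambda>y. h (vec d (x(k := 0))) + c * y" borel]
    show "(\<lambda>y. g (vec d (x(k := h (vec d (x(k := 0))) + c * y)))) \<in> borel_measurable lborel"
      by simp
  qed
  also have "\<dots> = (\<integral>\<^sup>+x. (\<integral>\<^sup>+y. ennreal \<bar>c\<bar> * g (upd_vec d (vec d (x(k := y))) k
      (c * vec d (x(k := y)) $ k + h (vec d (x(k := y))))) \<partial>lborel) \<partial>?P I)"
  proof (intro nn_integral_cong)
    fix x y
    show "ennreal \<bar>c\<bar> * g (vec d (x(k := h (vec d (x(k := 0))) + c * y)))
      = ennreal \<bar>c\<bar> * g (upd_vec d (vec d (x(k := y))) k (c * vec d (x(k := y)) $ k + h (vec d (x(k := y)))))"
      using k hv[of x y] by (simp add: upd add.commute)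
  qed
  also have "\<dots> = (\<integral>\<^sup>+x. ennreal \<bar>c\<bar> * g (upd_vec d (vec d x) k (c * vec d x $ k + h (vec d x))) \<partial>?P {..<d})"
    unfolding I(3) 
    by (rule product_nn_integral_insert[OF I(1,2), symmetric, of "\<lambda>x. ennreal \<bar>c\<bar> * g (upd_vec d (vec d x) k (c * vec d x $ k + h (vec d x)))"])
      (unfold I(3)[symmetric], measurable)
  also have "\<dots> = (\<integral>\<^sup>+x. ennreal \<bar>c\<bar> * g (upd_vec d x k (c * x $ k + h x)) \<partial>lborel_vec d)"
    by (rule nn_integral_lborel_vec[symmetric]) measurable
  also have "\<dots> = ennreal \<bar>c\<bar> * (\<integral>\<^sup>+x. g (upd_vec d x k (c * x $ k + h x)) \<partial>lborel_vec d)"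
    by (rule nn_integral_cmult) measurable
  finally show ?thesis ..
qed

section \<open>Linear change of variables\<close>

lemma measurable_mult_mat_vec:
  assumes A: "A \<in> carrier_mat d d"
  shows "(\<lambda>x. A *\<^sub>v x) \<in> measurable (lborel_vec d) (lborel_vec d)"
proof (rule measurable_lborel_vecI)
  fix i assume i: "i < d"
  have [measurable]: "(\<lambda>x. x $ j) \<in> borel_measurable (lborel_vec d)" if "j \<in> {0..<d}" for j
    using that by (intro measurable_vec_index) simp
  have "(\<lambda>x. \<Sum>j\<in>{0..<d}. row A i $ j * x $ j) \<in> borel_measurable (lborel_vec d)"
    by measurable
  then show "(\<lambda>x. (A *\<^sub>v x) $ i) \<in> borel_measurable (lborel_vec d)"
    by (rule measurable_cong[THEN iffD1, rotated]) (use A i in \<open>simp add: scalar_prod_def\<close>)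
qed (use A in simp)

lemma measurable_add_vec:
  assumes b: "b \<in> carrier_vec d"
  shows "(\<lambda>x. x + b) \<in> measurable (lborel_vec d) (lborel_vec d)"
proof (rule measurable_lborel_vecI)
  fix i assume i: "i < d"
  note measurable_vec_index[OF i, measurable]
  have "(\<lambda>x. x $ i + b $ i) \<in> borel_measurable (lborel_vec d)"
    by measurable
  then show "(\<lambda>x. (x + b) $ i) \<in> borel_measurable (lborel_vec d)"
    by (rule measurable_cong[THEN iffD1, rotated]) (use b i in simp)
qed (use b in simp)

text \<open>One coordinate is translated at a time: \<open>sh k\<close> is \<open>b\<close> cut off
  after its first \<open>k\<close> entries.\<close>

lemma nn_integral_shift:
  assumes b: "b \<in> carrier_vec d" and [measurable]: "g \<in> borel_measurable (lborel_vec d)"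
  shows "(\<integral>\<^sup>+x. g (x + b) \<partial>lborel_vec d) = (\<integral>\<^sup>+x. g x \<partial>lborel_vec d)"
proof -
  define sh where "sh k = vec d (\<lambda>i. if i < k then b $ i else 0)" for k
  have sh: "sh k \<in> carrier_vec d" for k
    by (simp add: sh_def)
  have "(\<integral>\<^sup>+x. g (x + sh k) \<partial>lborel_vec d) = (\<integral>\<^sup>+x. g x \<partial>lborel_vec d)" if "k \<le> d" for k
    using that
  proof (induction k)
    case 0
    have "x + sh 0 = x" if "x \<in> carrier_vec d" for x
      using that by (intro eq_vecI) (auto simp: sh_def)
    then show ?case
      by (intro nn_integral_cong) simp
  next
    case (Suc k)
    then have k: "k < d" by simp
    note measurable_add_vec[OF sh, measurable]
    have *: "upd_vec d x k (1 * x $ k + b $ k) + sh k = x + sh (Suc k)" if "x \<in> carrier_vec d" for x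
      using that by (intro eq_vecI) (auto simp: upd_vec_def sh_def less_Suc_eq)
    have "(\<integral>\<^sup>+x. g (x + sh k) \<partial>lborel_vec d)
        = ennreal \<bar>1\<bar> * (\<integral>\<^sup>+x. g (upd_vec d x k (1 * x $ k + b $ k) + sh k) \<partial>lborel_vec d)"
      by (rule nn_integral_affine_coordinate[OF k, symmetric]) (simp, measurable)
    also have "\<dots> = (\<integral>\<^sup>+x. g (x + sh (Suc k)) \<partial>lborel_vec d)"
      unfolding abs_one ennreal_1 mult_1_left[where 'a=ennreal] using * by (intro nn_integral_cong) simp
    finally show ?case
      using Suc k by simp
  qed
  moreover have "sh d = b"
    using b by (intro eq_vecI) (auto simp: sh_def)
  ultimately show ?thesis
    by (metis order.refl)
qed

lemma inverse_matE:
  fixes A :: "real mat"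
  assumes "A \<in> carrier_mat d d" "det A \<noteq> 0"
  obtains B where "B \<in> carrier_mat d d" "A * B = 1\<^sub>m d" "B * A = 1\<^sub>m d" "det B = 1 / det A"
proof -
  obtain B where B: "B \<in> carrier_mat d d" "A * B = 1\<^sub>m d" "B * A = 1\<^sub>m d"
    using det_non_zero_imp_unit[OF assms, of undefined] by (auto simp: Units_def ring_mat_def)
  have "det A * det B = 1"
    using det_mult[OF assms(1) B(1)] B(2) by simp
  then show thesis
    using B assms(2) by (intro that[of B]) (auto simp: field_simps)
qed

text \<open>Acts on a vector by changing only its entry \<open>k\<close>, which becomes the scalar
  product with \<open>v\<close>; this is the shape covered by
  \<open>nn_integral_affine_coordinate\<close>.\<close>

definition row_mat :: "nat \<Rightarrow> nat \<Rightarrow> real Matrix.vec \<Rightarrow> real mat" where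
  "row_mat d k v = mat d d (\<lambda>(i, j). if i = k then v $ j else if i = j then 1 else 0)"

lemma row_mat_carrier [simp]: "row_mat d k v \<in> carrier_mat d d"
  by (simp add: row_mat_def)

text \<open>The transpose is the identity with column \<open>k\<close> replaced by
  \<open>1 * v\<close>, whose determinant is given by Cramer's rule.\<close>

lemma det_row_mat:
  assumes k: "k < d" and v: "v \<in> carrier_vec d"
  shows "det (row_mat d k v) = v $ k"
proof -
  have "row_mat d k v = transpose_mat (replace_col (1\<^sub>m d) (1\<^sub>m d *\<^sub>v v) k)"
    using v k by (intro eq_matI) (auto simp: row_mat_def replace_col_def)
  moreover have "replace_col (1\<^sub>m d) (1\<^sub>m d *\<^sub>v v) k \<in> carrier_mat d d"
    by (simp add: replace_col_def)
  ultimately show ?thesis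
    using cramer_lemma_mat[OF one_carrier_mat v k] by (simp add: det_transpose)
qed

text \<open>A column operation: column \<open>j\<close> gains \<open>v $ j\<close> times column
  \<open>k\<close>, while column \<open>k\<close> itself is only scaled by
  \<open>v $ k\<close>.\<close>

lemma mult_row_mat:
  assumes A: "A \<in> carrier_mat d d" and k: "k < d" and v: "v \<in> carrier_vec d" and ij: "i < d" "j < d"
  shows "(A * row_mat d k v) $$ (i, j) = A $$ (i, k) * v $ j + (if j = k then 0 else A $$ (i, j))"
proof -
  have "(A * row_mat d k v) $$ (i, j) =
      (\<Sum>l\<in>{0..<d}. A $$ (i, l) * (if l = k then v $ j else if l = j then 1 else 0))"
    using A ij by (auto simp: scalar_prod_def row_mat_def intro!: sum.cong)
  also have "\<dots> = A $$ (i, k) * v $ j + (\<Sum>l\<in>{0..<d} - {k}. if l = j then A $$ (i, l) else 0)"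
  proof -
    have "(\<Sum>l\<in>{0..<d} - {k}. A $$ (i, l) * (if l = k then v $ j else if l = j then 1 else 0))
        = (\<Sum>l\<in>{0..<d} - {k}. if l = j then A $$ (i, l) else 0)"
      by (intro sum.cong) auto
    then show ?thesis
      using k by (subst sum.remove[of _ k]) auto
  qed
  also have "(\<Sum>l\<in>{0..<d} - {k}. if l = j then A $$ (i, l) else 0) = (if j = k then 0 else A $$ (i, j))"
    using ij by simp
  finally show ?thesis .
qed

lemma nn_integral_row_mat:
  assumes k: "k < d" and v: "v \<in> carrier_vec d" "v $ k \<noteq> 0"
    and [measurable]: "g \<in> borel_measurable (lborel_vec d)"
  shows "ennreal \<bar>v $ k\<bar> * (\<integral>\<^sup>+x. g (row_mat d k v *\<^sub>v x) \<partial>lborel_vec d) = (\<integral>\<^sup>+x. g x \<partial>lborel_vec d)"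
proof -
  define h where "h = (\<lambda>x::real Matrix.vec. \<Sum>j\<in>{0..<d} - {k}. v $ j * x $ j)"
  have [measurable]: "(\<lambda>x. x $ j) \<in> borel_measurable (lborel_vec d)" if "j \<in> {0..<d} - {k}" for j
    using that by (intro measurable_vec_index) simp
  have hm: "h \<in> borel_measurable (lborel_vec d)"
    unfolding h_def by measurable
  have hu: "h (upd_vec d x k t) = h x" for x t
    unfolding h_def by (intro sum.cong) (auto simp: upd_vec_def)
  have "row_mat d k v *\<^sub>v x = upd_vec d x k (v $ k * x $ k + h x)" if x: "x \<in> carrier_vec d" for x
  proof (rule eq_vecI)
    fix i assume "i < dim_vec (upd_vec d x k (v $ k * x $ k + h x))"
    then have i: "i < d" by (simp add: upd_vec_def)
    show "(row_mat d k v *\<^sub>v x) $ i = upd_vec d x k (v $ k * x $ k + h x) $ i"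
    proof (cases "i = k")
      case True
      have "(row_mat d k v *\<^sub>v x) $ k = (\<Sum>j\<in>{0..<d}. v $ j * x $ j)"
        using x k by (auto simp: scalar_prod_def row_mat_def intro!: sum.cong)
      also have "\<dots> = v $ k * x $ k + h x"
        unfolding h_def using k by (subst sum.remove[of _ k]) auto
      finally show ?thesis
        using True k by (simp add: upd_vec_def)
    next
      case False
      then show ?thesis
        using x i by (simp add: upd_vec_def scalar_prod_def row_mat_def mult_delta_left)
    qed
  qed (simp add: upd_vec_def row_mat_def)
  then have "(\<integral>\<^sup>+x. g (row_mat d k v *\<^sub>v x) \<partial>lborel_vec d)
      = (\<integral>\<^sup>+x. g (upd_vec d x k (v $ k * x $ k + h x)) \<partial>lborel_vec d)"
    by (intro nn_integral_cong) simp
  then show ?thesis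
    using nn_integral_affine_coordinate[OF k v(2) hm assms(4) hu] by simp
qed

text \<open>The formula passes to products because determinants multiply. Its validity for the
  factors is a hypothesis, so that the induction hypothesis can supply one of them.\<close>

lemma nn_integral_mult_mat:
  assumes A: "A \<in> carrier_mat d d" and B: "B \<in> carrier_mat d d"
    and covA: "\<And>g. g \<in> borel_measurable (lborel_vec d) \<Longrightarrow>
      ennreal \<bar>det A\<bar> * (\<integral>\<^sup>+x. g (A *\<^sub>v x) \<partial>lborel_vec d) = (\<integral>\<^sup>+x. g x \<partial>lborel_vec d)"
    and covB: "\<And>g. g \<in> borel_measurable (lborel_vec d) \<Longrightarrow>
      ennreal \<bar>det B\<bar> * (\<integral>\<^sup>+x. g (B *\<^sub>v x) \<partial>lborel_vec d) = (\<integral>\<^sup>+x. g x \<partial>lborel_vec d)"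
    and g [measurable]: "g \<in> borel_measurable (lborel_vec d)"
  shows "ennreal \<bar>det (A * B)\<bar> * (\<integral>\<^sup>+x. g ((A * B) *\<^sub>v x) \<partial>lborel_vec d) = (\<integral>\<^sup>+x. g x \<partial>lborel_vec d)"
proof -
  note measurable_mult_mat_vec[OF A, measurable]
  have "(\<integral>\<^sup>+x. g ((A * B) *\<^sub>v x) \<partial>lborel_vec d) = (\<integral>\<^sup>+x. g (A *\<^sub>v (B *\<^sub>v x)) \<partial>lborel_vec d)"
    using A B by (intro nn_integral_cong) (simp add: assoc_mult_mat_vec)
  then have "ennreal \<bar>det (A * B)\<bar> * (\<integral>\<^sup>+x. g ((A * B) *\<^sub>v x) \<partial>lborel_vec d)
      = ennreal \<bar>det A\<bar> * (ennreal \<bar>det B\<bar> * (\<integral>\<^sup>+x. g (A *\<^sub>v (B *\<^sub>v x)) \<partial>lborel_vec d))"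
    by (simp add: det_mult[OF A B] abs_mult ennreal_mult mult.assoc)
  also have "ennreal \<bar>det B\<bar> * (\<integral>\<^sup>+x. g (A *\<^sub>v (B *\<^sub>v x)) \<partial>lborel_vec d) = (\<integral>\<^sup>+x. g (A *\<^sub>v x) \<partial>lborel_vec d)"
    by (rule covB) measurable
  finally show ?thesis
    using covA[OF g] by simp
qed

text \<open>Right multiplication by row matrices turns the rows of \<open>A\<close> into unit vectors, last row first.\<close>

theorem nn_integral_linear:
  assumes A: "A \<in> carrier_mat d d" and "det A \<noteq> 0"
    and "g \<in> borel_measurable (lborel_vec d)"
  shows "ennreal \<bar>det A\<bar> * (\<integral>\<^sup>+x. g (A *\<^sub>v x) \<partial>lborel_vec d) = (\<integral>\<^sup>+x. g x \<partial>lborel_vec d)"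
proof -
  \<comment> \<open>\<open>k\<close> counts the leading rows still to be reduced: for
    \<open>k = d\<close> nothing is assumed about the rows, for \<open>k = 0\<close> the matrix is
    the identity.\<close>
  have "ennreal \<bar>det A\<bar> * (\<integral>\<^sup>+x. g (A *\<^sub>v x) \<partial>lborel_vec d) = (\<integral>\<^sup>+x. g x \<partial>lborel_vec d)"
    if "A \<in> carrier_mat d d" "det A \<noteq> 0" "k \<le> d"
      "\<And>i j. k \<le> i \<Longrightarrow> i < d \<Longrightarrow> j < d \<Longrightarrow> A $$ (i, j) = (if i = j then 1 else 0)"
      "g \<in> borel_measurable (lborel_vec d)" for A g k
    using that
  proof (induction k arbitrary: A g)
    case 0
    have "A = 1\<^sub>m d"
      using 0 by (intro eq_matI) auto
    moreover have "(\<integral>\<^sup>+x. g (1\<^sub>m d *\<^sub>v x) \<partial>lborel_vec d) = (\<integral>\<^sup>+x. g x \<partial>lborel_vec d)"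
      by (rule nn_integral_cong) simp
    ultimately show ?case
      by simp
  next
    case (Suc k)
    note [simp] = Suc.prems(1)
    have k: "k < d" using Suc.prems(3) by simp
    have covrow: "ennreal \<bar>det (row_mat d k v)\<bar> * (\<integral>\<^sup>+x. g (row_mat d k v *\<^sub>v x) \<partial>lborel_vec d)
        = (\<integral>\<^sup>+x. g x \<partial>lborel_vec d)"
      if "k < d" "v \<in> carrier_vec d" "v $ k \<noteq> 0" "g \<in> borel_measurable (lborel_vec d)" for k v g
      using nn_integral_row_mat[OF that] that by (simp add: det_row_mat)
    have main: "ennreal \<bar>det A\<bar> * (\<integral>\<^sup>+x. g (A *\<^sub>v x) \<partial>lborel_vec d) = (\<integral>\<^sup>+x. g x \<partial>lborel_vec d)"
      if A: "A \<in> carrier_mat d d" "det A \<noteq> 0" and nz: "A $$ (k, k) \<noteq> 0"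
        and rows: "\<And>i j. Suc k \<le> i \<Longrightarrow> i < d \<Longrightarrow> j < d \<Longrightarrow> A $$ (i, j) = (if i = j then 1 else 0)"
        and g: "g \<in> borel_measurable (lborel_vec d)" for A g
    proof -
      define v where "v = row A k"
      have v: "v \<in> carrier_vec d" "v $ k \<noteq> 0"
        using A nz k by (simp_all add: v_def)
      \<comment> \<open>The solution of \<open>A = A' * row_mat d k v\<close>, read off from
        \<open>mult_row_mat\<close>: column \<open>k\<close> is divided by the pivot, and multiples
        of the result are subtracted from the other columns. Row \<open>k\<close> becomes a unit
        vector; the later rows do not change, since they vanish in column \<open>k\<close>.\<close>
      define A' where "A' = mat d d (\<lambda>(i, j). if j = k then A $$ (i, k) / v $ k
        else A $$ (i, j) - A $$ (i, k) / v $ k * v $ j)"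
      have A': "A' \<in> carrier_mat d d"
        by (simp add: A'_def)
      have eq: "A = A' * row_mat d k v"
      proof (rule eq_matI)
        fix i j assume "i < dim_row (A' * row_mat d k v)" "j < dim_col (A' * row_mat d k v)"
        then have ij: "i < d" "j < d"
          by (simp_all add: A'_def row_mat_def)
        have "(A' * row_mat d k v) $$ (i, j) = A $$ (i, j)"
          unfolding mult_row_mat[OF A' k v(1) ij] using ij k v(2)
          by (auto simp: A'_def)
        then show "A $$ (i, j) = (A' * row_mat d k v) $$ (i, j)" ..
      qed (use A in \<open>auto simp: A'_def row_mat_def\<close>)
      have detA': "det A' \<noteq> 0"
        using A(2) eq det_mult[OF A' row_mat_carrier] by auto
      have rows': "A' $$ (i, j) = (if i = j then 1 else 0)" if "k \<le> i" "i < d" "j < d" for i j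
      proof (cases "i = k")
        case True
        then show ?thesis using that v k A by (auto simp: A'_def v_def)
      next
        case False
        then show ?thesis using that v k rows[of i] by (auto simp: A'_def)
      qed
      show ?thesis
        unfolding eq
        by (rule nn_integral_mult_mat[OF A' row_mat_carrier Suc.IH[OF A' detA' _ rows'] covrow[OF k v] g])
          (use k in simp_all)
    qed
    show ?case
    proof (cases "A $$ (k, k) = 0")
      case False
      then show ?thesis using main Suc.prems by blast
    next
      case True
      \<comment> \<open>Otherwise row \<open>k\<close> would be a combination of the unit rows after
        it. Concretely, these unit rows force column \<open>k\<close> of the inverse to vanish after
        position \<open>k\<close>, so row \<open>k\<close> times that column would be 0 instead of
        1.\<close>
      have "\<exists>j<k. A $$ (k, j) \<noteq> 0"
      proof (rule ccontr)
        assume "\<not> ?thesis"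
        then have z: "A $$ (k, j) = 0" if "j \<le> k" for j
          using that True by (cases "j = k") auto
        obtain B where B: "B \<in> carrier_mat d d" "A * B = 1\<^sub>m d"
          using inverse_matE[OF Suc.prems(1,2)] by metis
        have AB: "(\<Sum>l\<in>{0..<d}. A $$ (i, l) * B $$ (l, k)) = (if i = k then 1 else 0)" if "i < d" for i
          using arg_cong[OF B(2), of "\<lambda>M. M $$ (i, k)"] that k B(1) Suc.prems(1)
          by (simp add: scalar_prod_def)
        have Bz: "B $$ (l, k) = 0" if l: "k < l" "l < d" for l
        proof -
          have "(\<Sum>j\<in>{0..<d}. A $$ (l, j) * B $$ (j, k)) = (\<Sum>j\<in>{0..<d}. if l = j then B $$ (j, k) else 0)"
            using Suc.prems(4)[of l] l by (intro sum.cong) auto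
          then show ?thesis
            using AB[of l] l by simp
        qed
        have "(\<Sum>l\<in>{0..<d}. A $$ (k, l) * B $$ (l, k)) = 0"
        proof (rule sum.neutral, rule ballI)
          fix l assume "l \<in> {0..<d}"
          then show "A $$ (k, l) * B $$ (l, k) = 0"
            using z[of l] Bz[of l] by (cases "l \<le> k") auto
        qed
        then show False
          using AB[OF k] by simp
      qed
      then obtain j where j: "j < k" "A $$ (k, j) \<noteq> 0" by blast
      have jd: "j < d" using j k by simp
      \<comment> \<open>Multiplying by the row matrix of \<open>p\<close> adds column
        \<open>j\<close> to column \<open>k\<close>, which moves a nonzero entry into the pivot
        position; \<open>q\<close> undoes this. Both matrices have determinant 1.\<close>
      define p q :: "real Matrix.vec" where "p = unit_vec d j + unit_vec d k"
        and "q = unit_vec d j - unit_vec d k"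
      have pq: "p \<in> carrier_vec d" "p $ j = 1" "q \<in> carrier_vec d" "q $ j = 1"
        using j jd k by (simp_all add: p_def q_def)
      define A' where "A' = A * row_mat d j p"
      have A': "A' \<in> carrier_mat d d"
        by (simp add: A'_def mult_carrier_mat[OF Suc.prems(1) row_mat_carrier])
      have A'_ij: "A' $$ (i, l) = A $$ (i, j) * p $ l + (if l = j then 0 else A $$ (i, l))"
        if "i < d" "l < d" for i l
        unfolding A'_def by (rule mult_row_mat[OF Suc.prems(1) jd pq(1) that])
      have eq: "A = A' * row_mat d j q"
      proof (rule eq_matI)
        fix i l assume "i < dim_row (A' * row_mat d j q)" "l < dim_col (A' * row_mat d j q)"
        then have il: "i < d" "l < d"
          by (simp_all add: row_mat_def A'_def carrier_matD[OF Suc.prems(1)])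
        have "(A' * row_mat d j q) $$ (i, l) = A $$ (i, l)"
          unfolding mult_row_mat[OF A' jd pq(3) il] A'_ij[OF il] A'_ij[OF il(1) jd] using il jd k j
          by (auto simp: p_def q_def)
        then show "A $$ (i, l) = (A' * row_mat d j q) $$ (i, l)" ..
      qed (simp_all add: row_mat_def A'_def carrier_matD[OF Suc.prems(1)])
      have detA': "det A' \<noteq> 0"
        using Suc.prems(2) det_mult[OF Suc.prems(1) row_mat_carrier] det_row_mat[OF jd pq(1)] pq
        by (simp add: A'_def)
      have nz: "A' $$ (k, k) \<noteq> 0"
        using j k True by (simp add: A'_ij p_def)
      have rows': "A' $$ (i, l) = (if i = l then 1 else 0)" if "Suc k \<le> i" "i < d" "l < d" for i l
        using that j jd Suc.prems(4)[OF that(1,2)] by (auto simp: A'_ij)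
      show ?thesis
        unfolding eq
        by (rule nn_integral_mult_mat[OF A' row_mat_carrier main[OF A' detA' nz rows'] covrow[OF jd pq(3)] Suc.prems(5)])
          (use pq in simp_all)
    qed
  qed
  from this[OF A assms(2) order.refl _ assms(3)] show ?thesis
    by simp
qed

section \<open>Enclosing ellipsoids\<close>

definition outer :: "nat \<Rightarrow> real Matrix.vec \<Rightarrow> real mat" where
  "outer d u = mat d d (\<lambda>(i, j). u $ i * u $ j)"

lemma outer_carrier [simp]: "outer d u \<in> carrier_mat d d"
  by (simp add: outer_def)

text \<open>The bordered matrix \<open>Z\<close> is multiplied by two unitriangular matrices:
  \<open>L\<close> clears its lower left block, \<open>R\<close> its upper right block. Both
  products have the determinant of \<open>Z\<close>, and the two block triangular results give the
  two sides.\<close>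

lemma det_one_plus_outer:
  assumes u: "u \<in> carrier_vec d"
  shows "det (1\<^sub>m d + c \<cdot>\<^sub>m outer d u) = 1 + c * (u \<bullet> u)"
proof -
  define U where "U = mat d (Suc 0) (\<lambda>(i, j). u $ i)"
  define V where "V = mat (Suc 0) d (\<lambda>(i, j). u $ j)"
  define Z where "Z = four_block_mat (1\<^sub>m d) ((- c) \<cdot>\<^sub>m U) V (1\<^sub>m (Suc 0))"
  have [simp]: "U \<in> carrier_mat d (Suc 0)" "V \<in> carrier_mat (Suc 0) d"
    by (simp_all add: U_def V_def)
  have UV: "U * V = outer d u"
    by (intro eq_matI) (auto simp: U_def V_def outer_def scalar_prod_def)
  have VU: "V * U = mat (Suc 0) (Suc 0) (\<lambda>_. u \<bullet> u)"
    using u by (intro eq_matI) (auto simp: U_def V_def scalar_prod_def)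
  have Z: "Z \<in> carrier_mat (d + Suc 0) (d + Suc 0)"
    unfolding Z_def by (rule four_block_carrier_mat) simp_all
  define L where "L = four_block_mat (1\<^sub>m d) (0\<^sub>m d (Suc 0)) ((- 1) \<cdot>\<^sub>m V) (1\<^sub>m (Suc 0))"
  define R where "R = four_block_mat (1\<^sub>m d) (c \<cdot>\<^sub>m U) (0\<^sub>m (Suc 0) d) (1\<^sub>m (Suc 0))"
  have L: "L \<in> carrier_mat (d + Suc 0) (d + Suc 0)" and R: "R \<in> carrier_mat (d + Suc 0) (d + Suc 0)"
    unfolding L_def R_def by (rule four_block_carrier_mat; simp)+
  have detL: "det L = 1"
    unfolding L_def by (subst det_four_block_mat_upper_right_zero[of _ d _ "Suc 0"]) simp_all
  have detR: "det R = 1"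
    unfolding R_def by (subst det_four_block_mat_lower_left_zero[of _ d _ "Suc 0"]) simp_all
  have "Z * L = four_block_mat (1\<^sub>m d + c \<cdot>\<^sub>m outer d u) ((- c) \<cdot>\<^sub>m U) (0\<^sub>m (Suc 0) d) (1\<^sub>m (Suc 0))"
    unfolding Z_def L_def
    by (subst mult_four_block_mat[of _ d d _ "Suc 0" _ "Suc 0" _ _ d _ "Suc 0"])
      (auto simp: UV[symmetric] U_def V_def scalar_prod_def intro!: cong_four_block_mat eq_matI)
  then have 1: "det (Z * L) = det (1\<^sub>m d + c \<cdot>\<^sub>m outer d u)"
    by (simp add: det_four_block_mat_lower_left_zero[of _ d _ "Suc 0"])
  have "Z * R = four_block_mat (1\<^sub>m d) (0\<^sub>m d (Suc 0)) V (mat (Suc 0) (Suc 0) (\<lambda>_. 1 + c * (u \<bullet> u)))"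
    unfolding Z_def R_def
    by (subst mult_four_block_mat[of _ d d _ "Suc 0" _ "Suc 0" _ _ d _ "Suc 0"])
      (use u in \<open>auto simp: U_def V_def scalar_prod_def sum_distrib_left ac_simps intro!: cong_four_block_mat eq_matI\<close>)
  then have 2: "det (Z * R) = 1 + c * (u \<bullet> u)"
    by (simp add: det_four_block_mat_upper_right_zero[of _ d _ "Suc 0"] det_single)
  show ?thesis
    using 1 2 det_mult[OF Z L] det_mult[OF Z R] detL detR by simp
qed

text \<open>The square root of \<open>1 + c u u\<^sup>T\<close> is \<open>1 + \<gamma> u u\<^sup>T\<close> with \<open>2 \<gamma> + \<gamma>\<^sup>2 (u \<bullet> u) = c\<close>.\<close>

lemma rank_one_square_root:
  assumes u: "u \<in> carrier_vec d" and pos: "1 + c * (u \<bullet> u) > 0"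
  obtains G where "G \<in> carrier_mat d d" "G * transpose_mat G = 1\<^sub>m d + c \<cdot>\<^sub>m outer d u"
    "(det G)\<^sup>2 = 1 + c * (u \<bullet> u)"
proof -
  define w where "w = sqrt (1 + c * (u \<bullet> u))"
  \<comment> \<open>This is \<open>(w - 1) / (u \<bullet> u)\<close> rationalized, so that
    \<open>u = 0\<close> needs no separate case.\<close>
  define g where "g = c / (1 + w)"
  have w: "w > 0" "w\<^sup>2 = 1 + c * (u \<bullet> u)"
    using pos by (simp_all add: w_def)
  then have ww: "c * (u \<bullet> u) = (w - 1) * (1 + w)"
    by (simp add: algebra_simps power2_eq_square)
  have gw: "g * (u \<bullet> u) = w - 1"
    using w(1) ww by (simp add: g_def field_simps)
  have "g * (1 + w) = c"
    using w(1) by (simp add: g_def)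
  then have gc: "2 * g + g * g * (u \<bullet> u) = c"
    by (simp add: mult.assoc gw algebra_simps)
  define G where "G = 1\<^sub>m d + g \<cdot>\<^sub>m outer d u"
  have "G * transpose_mat G = 1\<^sub>m d + c \<cdot>\<^sub>m outer d u"
  proof (rule eq_matI)
    fix i j assume "i < dim_row (1\<^sub>m d + c \<cdot>\<^sub>m outer d u)" "j < dim_col (1\<^sub>m d + c \<cdot>\<^sub>m outer d u)"
    then have ij: "i < d" "j < d" by (simp_all add: outer_def)
    have "(G * transpose_mat G) $$ (i, j)
        = (\<Sum>l\<in>{0..<d}. ((if i = l then 1 else 0) + g * (u $ i * u $ l))
            * ((if j = l then 1 else 0) + g * (u $ j * u $ l)))"
      using ij by (auto simp: G_def outer_def scalar_prod_def intro!: sum.cong)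
    also have "\<dots> = (\<Sum>l\<in>{0..<d}. (if i = l then (if j = l then 1 else 0) else 0)
        + (if i = l then g * (u $ j * u $ l) else 0) + (if j = l then g * (u $ i * u $ l) else 0)
        + g * g * u $ i * u $ j * (u $ l * u $ l))"
      by (intro sum.cong) (auto simp: algebra_simps)
    also have "\<dots> = (if i = j then 1 else 0) + (2 * g + g * g * (\<Sum>l\<in>{0..<d}. u $ l * u $ l)) * (u $ i * u $ j)"
      unfolding sum.distrib sum_distrib_left[symmetric] using ij by (simp add: algebra_simps)
    also have "(\<Sum>l\<in>{0..<d}. u $ l * u $ l) = u \<bullet> u"
      using u by (simp add: scalar_prod_def)
    finally show "(G * transpose_mat G) $$ (i, j) = (1\<^sub>m d + c \<cdot>\<^sub>m outer d u) $$ (i, j)"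
      using ij by (simp add: gc outer_def)
  qed (simp_all add: G_def outer_def)
  moreover have "(det G)\<^sup>2 = 1 + c * (u \<bullet> u)"
    unfolding G_def det_one_plus_outer[OF u] gw by (simp add: w(2))
  ultimately show thesis
    by (intro that[of G]) (simp_all add: G_def)
qed

lemma index_mult_sum:
  assumes "A \<in> carrier_mat n m" "B \<in> carrier_mat m p" "i < n" "j < p"
  shows "(A * B) $$ (i, j) = (\<Sum>k\<in>{0..<m}. A $$ (i, k) * B $$ (k, j))"
  using assms by (simp add: scalar_prod_def)

lemma mult_outer:
  assumes B: "B \<in> carrier_mat d d" and u: "u \<in> carrier_vec d"
  shows "B * outer d u * transpose_mat B = outer d (B *\<^sub>v u)"
proof (rule eq_matI)
  fix i j assume "i < dim_row (outer d (B *\<^sub>v u))" "j < dim_col (outer d (B *\<^sub>v u))"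
  then have ij: "i < d" "j < d" by (simp_all add: outer_def)
  have Bu: "(B *\<^sub>v u) $ i = (\<Sum>l\<in>{0..<d}. B $$ (i, l) * u $ l)" if "i < d" for i
    using that B u by (simp add: scalar_prod_def)
  have "(B * outer d u) $$ (i, l) = (B *\<^sub>v u) $ i * u $ l" if "l < d" for l
  proof -
    have "(B * outer d u) $$ (i, l) = (\<Sum>k\<in>{0..<d}. B $$ (i, k) * (u $ k * u $ l))"
      using that ij B by (simp add: outer_def scalar_prod_def)
    then show ?thesis
      unfolding Bu[OF ij(1)] by (simp only: sum_distrib_right mult.assoc)
  qed
  moreover have "(B * outer d u * transpose_mat B) $$ (i, j) = (\<Sum>l\<in>{0..<d}. (B * outer d u) $$ (i, l) * B $$ (j, l))"
    using ij B by (subst index_mult_sum[OF mult_carrier_mat[OF B outer_carrier]]) auto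
  ultimately have "(B * outer d u * transpose_mat B) $$ (i, j) = (\<Sum>l\<in>{0..<d}. ((B *\<^sub>v u) $ i * u $ l) * B $$ (j, l))"
    by simp
  also have "\<dots> = (B *\<^sub>v u) $ i * (B *\<^sub>v u) $ j"
    unfolding Bu[OF ij(2)] sum_distrib_left by (simp add: ac_simps)
  also have "\<dots> = outer d (B *\<^sub>v u) $$ (i, j)"
    using ij by (simp add: outer_def)
  finally show "(B * outer d u * transpose_mat B) $$ (i, j) = outer d (B *\<^sub>v u) $$ (i, j)" .
qed (use B in \<open>auto simp: outer_def\<close>)

text \<open>\<open>B' = B * G\<close> with \<open>G\<close> the square root of the rank-one
  perturbation of the identity. The positivity condition admits both uses: adding a point with
  \<open>c = 1\<close>, and removing with \<open>c = - 1\<close> a point for which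
  \<open>u \<bullet> u < 1\<close>.\<close>

lemma rank_one_update:
  assumes B: "B \<in> carrier_mat d d" and u: "u \<in> carrier_vec d" and pos: "1 + c * (u \<bullet> u) > 0"
  obtains B' where "B' \<in> carrier_mat d d"
    "B' * transpose_mat B' = B * transpose_mat B + c \<cdot>\<^sub>m outer d (B *\<^sub>v u)"
    "(det B')\<^sup>2 = (det B)\<^sup>2 * (1 + c * (u \<bullet> u))"
proof -
  obtain G where G: "G \<in> carrier_mat d d" "G * transpose_mat G = 1\<^sub>m d + c \<cdot>\<^sub>m outer d u"
    "(det G)\<^sup>2 = 1 + c * (u \<bullet> u)"
    using rank_one_square_root[OF u pos] by metis
  note T [simp] = transpose_carrier_mat[THEN iffD2, OF B] transpose_carrier_mat[THEN iffD2, OF G(1)]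
  have "B * G * transpose_mat (B * G) = B * (G * transpose_mat G) * transpose_mat B"
    unfolding transpose_mult[OF B G(1)] using B G(1)
    by (simp add: assoc_mult_mat[of _ d d _ d _ d])
  also have "\<dots> = (B + c \<cdot>\<^sub>m (B * outer d u)) * transpose_mat B"
    unfolding G(2) using B
    by (subst mult_add_distrib_mat[OF B, of _ d]) (simp_all add: mult_smult_distrib[OF B outer_carrier])
  also have "\<dots> = B * transpose_mat B + c \<cdot>\<^sub>m (B * outer d u * transpose_mat B)"
    using B mult_carrier_mat[OF B outer_carrier, of u]
    by (simp add: add_mult_distrib_mat[of _ d d] mult_smult_assoc_mat[of _ d d _ d])
  finally have "B * G * transpose_mat (B * G) = B * transpose_mat B + c \<cdot>\<^sub>m outer d (B *\<^sub>v u)"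
    unfolding mult_outer[OF B u] .
  then show thesis
    using B G by (intro that[of "B * G"]) (simp_all add: det_mult[OF B G(1)] power_mult_distrib)
qed

section \<open>Gram matrices and their determinants\<close>

definition gram :: "nat \<Rightarrow> real Matrix.vec list \<Rightarrow> real mat" where
  "gram d xs = mat d d (\<lambda>(i, j). \<Sum>x\<leftarrow>xs. x $ i * x $ j)"

lemma gram_Cons: "gram d (x # xs) = gram d xs + 1 \<cdot>\<^sub>m outer d x"
  by (intro eq_matI) (auto simp: gram_def outer_def)

lemma gram_remove1: "x \<in> set xs \<Longrightarrow> gram d (remove1 x xs) = gram d xs + (- 1) \<cdot>\<^sub>m outer d x"
  by (intro eq_matI) (auto simp: gram_def outer_def sum_list_map_remove1)

lemma gram_mat_of_cols:
  assumes "length xs = d" "set xs \<subseteq> carrier_vec d"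
  shows "mat_of_cols d xs * transpose_mat (mat_of_cols d xs) = gram d xs"
proof (rule eq_matI)
  fix i j assume "i < dim_row (gram d xs)" "j < dim_col (gram d xs)"
  then have "i < d" "j < d" by (simp_all add: gram_def)
  then show "(mat_of_cols d xs * transpose_mat (mat_of_cols d xs)) $$ (i, j) = gram d xs $$ (i, j)"
    using assms by (auto simp: gram_def scalar_prod_def mat_of_cols_def sum_list_sum_nth intro!: sum.cong)
qed (use assms in \<open>simp_all add: gram_def\<close>)

lemma det_square_transpose:
  assumes "B \<in> carrier_mat d d"
  shows "det (B * transpose_mat B) = (det B)\<^sup>2"
  using assms by (simp add: det_mult[of _ d] det_transpose power2_eq_square)

text \<open>The sum is the trace of \<open>C * gram d xs * transpose_mat C\<close>, which is the
  identity; the proof evaluates the diagonal entries one by one.\<close>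

lemma sum_list_inverse_gram:
  assumes B: "B \<in> carrier_mat d d" and C: "C \<in> carrier_mat d d" "C * B = 1\<^sub>m d"
    and gram: "B * transpose_mat B = gram d xs" and xs: "set xs \<subseteq> carrier_vec d"
  shows "(\<Sum>x\<leftarrow>xs. (C *\<^sub>v x) \<bullet> (C *\<^sub>v x)) = real d"
proof -
  have "C * gram d xs * transpose_mat C = (C * B) * transpose_mat (C * B)"
    unfolding gram[symmetric] transpose_mult[OF C(1) B] using B C(1)
    by (simp add: assoc_mult_mat[of _ d d _ d _ d])
  then have one: "C * gram d xs * transpose_mat C = 1\<^sub>m d"
    using C(2) by simp
  have coord: "(\<Sum>x\<leftarrow>xs. ((C *\<^sub>v x) $ i)\<^sup>2) = 1" if i: "i < d" for i
  proof -
    have "1 = (C * gram d xs * transpose_mat C) $$ (i, i)"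
      using i one by simp
    also have "\<dots> = (\<Sum>k\<in>{0..<d}. (\<Sum>j\<in>{0..<d}. C $$ (i, j) * (\<Sum>x\<leftarrow>xs. x $ j * x $ k)) * C $$ (i, k))"
      using i C(1) by (auto simp: scalar_prod_def gram_def intro!: sum.cong)
    also have "\<dots> = (\<Sum>x\<leftarrow>xs. (\<Sum>k\<in>{0..<d}. (\<Sum>j\<in>{0..<d}. C $$ (i, j) * (x $ j * x $ k)) * C $$ (i, k)))"
      by (induction xs) (simp_all add: sum.distrib distrib_left distrib_right)
    also have "\<dots> = (\<Sum>x\<leftarrow>xs. ((C *\<^sub>v x) $ i)\<^sup>2)"
    proof (rule arg_cong[of _ _ sum_list], rule map_cong[OF refl])
      fix x assume "x \<in> set xs"
      then have "(C *\<^sub>v x) $ i = (\<Sum>j\<in>{0..<d}. C $$ (i, j) * x $ j)"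
        using xs i C(1) by (auto simp: scalar_prod_def)
      then show "(\<Sum>k\<in>{0..<d}. (\<Sum>j\<in>{0..<d}. C $$ (i, j) * (x $ j * x $ k)) * C $$ (i, k)) = ((C *\<^sub>v x) $ i)\<^sup>2"
        by (simp add: power2_eq_square sum_distrib_left sum_distrib_right ac_simps)
    qed
    finally show ?thesis ..
  qed
  have "(C *\<^sub>v x) \<bullet> (C *\<^sub>v x) = (\<Sum>i\<in>{0..<d}. ((C *\<^sub>v x) $ i)\<^sup>2)" for x
    using C(1) by (simp add: scalar_prod_def power2_eq_square)
  then have "(\<Sum>x\<leftarrow>xs. (C *\<^sub>v x) \<bullet> (C *\<^sub>v x)) = (\<Sum>i\<in>{0..<d}. \<Sum>x\<leftarrow>xs. ((C *\<^sub>v x) $ i)\<^sup>2)"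
    by (induction xs) (simp_all add: sum.distrib)
  then show ?thesis
    using coord by simp
qed

text \<open>This replaces the Cauchy-Binet formula: some point of the list can be removed from the Gram
  matrix at the cost of a factor \<open>1 - d / length xs\<close> in the determinant.\<close>

lemma det_gram_le:
  assumes "B \<in> carrier_mat d d" "B * transpose_mat B = gram d xs" "set xs \<subseteq> K" "length xs = d + n"
    and K: "K \<subseteq> carrier_vec d"
    and D: "\<And>X. X \<in> carrier_mat d d \<Longrightarrow> (\<And>j. j < d \<Longrightarrow> col X j \<in> K) \<Longrightarrow> \<bar>det X\<bar> \<le> D"
  shows "(det B)\<^sup>2 \<le> real ((d + n) choose d) * D\<^sup>2"
  using assms(1-4)
proof (induction n arbitrary: B xs)
  case 0
  have X: "mat_of_cols d xs \<in> carrier_mat d d"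
    using 0 by (metis add.right_neutral mat_of_cols_carrier(1))
  have "col (mat_of_cols d xs) j \<in> K" if "j < d" for j
    using that 0 K by (subst col_mat_of_cols) (auto dest!: nth_mem)
  then have "\<bar>det (mat_of_cols d xs)\<bar> \<le> D"
    by (rule D[OF X])
  then have "(det (mat_of_cols d xs))\<^sup>2 \<le> D\<^sup>2"
    by (metis abs_ge_zero power2_abs power_mono)
  moreover have "(det B)\<^sup>2 = (det (mat_of_cols d xs))\<^sup>2"
    using 0 K det_square_transpose[OF X] det_square_transpose[of B d] gram_mat_of_cols[of xs d] by auto
  ultimately show ?case by simp
next
  case (Suc n)
  show ?case
  proof (cases "det B = 0")
    case False
    obtain C where C: "C \<in> carrier_mat d d" "B * C = 1\<^sub>m d" "C * B = 1\<^sub>m d"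
      using inverse_matE[OF Suc.prems(1) False] by metis
    have xs: "set xs \<subseteq> carrier_vec d" using Suc.prems K by auto
    \<comment> \<open>The values sum to \<open>d\<close>, so some point is at or below the
      average.\<close>
    have "\<exists>x\<in>set xs. (C *\<^sub>v x) \<bullet> (C *\<^sub>v x) \<le> real d / real (length xs)"
    proof (rule ccontr)
      assume "\<not> ?thesis"
      then have "(\<Sum>x\<leftarrow>xs. real d / real (length xs)) < (\<Sum>x\<leftarrow>xs. (C *\<^sub>v x) \<bullet> (C *\<^sub>v x))"
        using Suc.prems by (intro sum_list_strict_mono) auto
      also have "\<dots> = real d"
        by (rule sum_list_inverse_gram[OF Suc.prems(1) C(1,3) Suc.prems(2) xs])
      finally show False
        using Suc.prems by (simp add: sum_list_triv)
    qed
    then obtain x where x: "x \<in> set xs" "(C *\<^sub>v x) \<bullet> (C *\<^sub>v x) \<le> real d / real (length xs)" ..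
    define u where "u = C *\<^sub>v x"
    have xc: "x \<in> carrier_vec d" using x xs by auto
    have u: "u \<in> carrier_vec d" "B *\<^sub>v u = x"
      using C xc Suc.prems(1) unfolding u_def by (auto simp flip: assoc_mult_mat_vec)
    have low: "1 + (- 1) * (u \<bullet> u) \<ge> real (Suc n) / real (d + Suc n)"
      using x(2) Suc.prems(4) unfolding u_def by (simp add: field_simps)
    then have pos: "1 + (- 1) * (u \<bullet> u) > 0"
      by (rule less_le_trans[rotated]) simp
    obtain B' where B': "B' \<in> carrier_mat d d"
      "B' * transpose_mat B' = B * transpose_mat B + (- 1) \<cdot>\<^sub>m outer d (B *\<^sub>v u)"
      "(det B')\<^sup>2 = (det B)\<^sup>2 * (1 + (- 1) * (u \<bullet> u))"
      using rank_one_update[OF Suc.prems(1) u(1) pos] by metis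
    have "(det B')\<^sup>2 \<le> real ((d + n) choose d) * D\<^sup>2"
    proof (rule Suc.IH[OF B'(1)])
      show "B' * transpose_mat B' = gram d (remove1 x xs)"
        unfolding B'(2) u(2) Suc.prems(2) gram_remove1[OF x(1)] ..
      show "set (remove1 x xs) \<subseteq> K"
        using Suc.prems(3) set_remove1_subset[of x xs] by blast
      show "length (remove1 x xs) = d + n"
        using x(1) Suc.prems(4) by (simp add: length_remove1)
    qed
    then have "(det B)\<^sup>2 * (real (Suc n) / real (d + Suc n)) \<le> real ((d + n) choose d) * D\<^sup>2"
      unfolding B'(3) using low by (meson mult_left_mono order_trans zero_le_power2)
    then have "(det B)\<^sup>2 \<le> real (d + Suc n) * real ((d + n) choose d) / real (Suc n) * D\<^sup>2"
      by (simp add: field_simps)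
    \<comment> \<open>The factors \<open>(d + n + 1) / (n + 1)\<close> lost in the successive
      removals telescope to a binomial coefficient.\<close>
    also have "real (d + Suc n) * real ((d + n) choose d) / real (Suc n) = real ((d + Suc n) choose d)"
    proof -
      have "Suc n * (Suc (d + n) choose Suc n) = Suc (d + n) * ((d + n) choose n)"
        by (metis Suc_times_binomial_eq mult.commute)
      moreover have "(Suc (d + n) choose Suc n) = (Suc (d + n) choose d)" "((d + n) choose n) = ((d + n) choose d)"
        using binomial_symmetric[of d "Suc (d + n)"] binomial_symmetric[of d "d + n"] by (simp_all add: Suc_diff_le)
      ultimately have "Suc n * ((d + Suc n) choose d) = (d + Suc n) * ((d + n) choose d)"
        by simp
      then have "real (Suc n) * real ((d + Suc n) choose d) = real (d + Suc n) * real ((d + n) choose d)"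
        by (metis of_nat_mult)
      then show ?thesis by (simp add: field_simps)
    qed
    finally show ?thesis .
  qed simp
qed

text \<open>Starting from \<open>d\<close> points of almost maximal determinant, every point of \<open>K\<close> outside the current
  ellipsoid is added to the Gram matrix, which multiplies the squared determinant by at least 4; by
  \<open>det_gram_le\<close> this stops after about \<open>d\<close> steps.\<close>

lemma enclosing_ellipsoid:
  fixes K :: "real Matrix.vec set" and D :: real
  assumes K: "K \<subseteq> carrier_vec d"
    and D: "\<And>X. X \<in> carrier_mat d d \<Longrightarrow> (\<And>j. j < d \<Longrightarrow> col X j \<in> K) \<Longrightarrow> \<bar>det X\<bar> \<le> D" and "D > 0"
    and X: "X \<in> carrier_mat d d" "\<And>j. j < d \<Longrightarrow> col X j \<in> K" "\<bar>det X\<bar> \<ge> D / 2"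
  obtains B where "B \<in> carrier_mat d d" "det B \<noteq> 0" "\<bar>det B\<bar> \<le> 2 ^ (d + 1) * D"
    "\<And>u. u \<in> carrier_vec d \<Longrightarrow> B *\<^sub>v u \<in> K \<Longrightarrow> u \<bullet> u \<le> 3"
proof (rule ccontr)
  \<comment> \<open>Under the negated goal, \<open>good\<close> produces a point of \<open>K\<close>
    outside the ellipsoid of any \<open>B\<close> that is nonsingular and satisfies the determinant
    bound.\<close>
  note good = that
  assume neg: "\<not> thesis"
  have upper: "(det B)\<^sup>2 \<le> 2 ^ (d + m) * D\<^sup>2"
    if "B \<in> carrier_mat d d" "B * transpose_mat B = gram d xs" "set xs \<subseteq> K" "length xs = d + m" for B xs m
  proof -
    have "(det B)\<^sup>2 \<le> real ((d + m) choose d) * D\<^sup>2"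
      by (rule det_gram_le[OF that K D])
    also have "\<dots> \<le> 2 ^ (d + m) * D\<^sup>2"
    proof (rule mult_right_mono)
      have "(d + m) choose d \<le> 2 ^ (d + m)"
        by (rule binomial_le_pow2)
      then show "real ((d + m) choose d) \<le> 2 ^ (d + m)"
        by (metis of_nat_le_iff of_nat_numeral of_nat_power)
    qed simp
    finally show ?thesis .
  qed
  \<comment> \<open>The factor 4 on the right pays for starting with
    \<open>\<bar>det X\<bar> \<ge> D / 2\<close>. Each new point multiplies the squared determinant
    by \<open>1 + u \<bullet> u\<close>, which exceeds 4; this is where the bound 3 on
    \<open>u \<bullet> u\<close> comes from.\<close>
  have "\<exists>B xs. B \<in> carrier_mat d d \<and> B * transpose_mat B = gram d xs \<and> set xs \<subseteq> K \<and> length xs = d + m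
      \<and> 4 ^ m * D\<^sup>2 \<le> 4 * (det B)\<^sup>2" if "m \<le> d + 3" for m
    using that
  proof (induction m)
    case 0
    define xs where "xs = map (col X) [0..<d]"
    have xs: "length xs = d" "set xs \<subseteq> K"
      using X(2) by (auto simp: xs_def)
    have "mat_of_cols d xs = X"
      using X(1) by (intro eq_matI) (auto simp: xs_def mat_of_cols_def)
    then have "X * transpose_mat X = gram d xs"
      using gram_mat_of_cols[of xs d] xs K by auto
    moreover have "D\<^sup>2 \<le> 4 * (det X)\<^sup>2"
    proof -
      have "D\<^sup>2 \<le> (2 * \<bar>det X\<bar>)\<^sup>2"
        using X(3) \<open>D > 0\<close> by (intro power_mono) auto
      then show ?thesis by (simp add: power_mult_distrib)
    qed
    ultimately show ?case
      using X(1) xs by auto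
  next
    case (Suc m)
    then obtain B xs where B: "B \<in> carrier_mat d d" "B * transpose_mat B = gram d xs" "set xs \<subseteq> K"
        "length xs = d + m" "4 ^ m * D\<^sup>2 \<le> 4 * (det B)\<^sup>2"
      by auto
    have nz: "det B \<noteq> 0"
    proof
      assume "det B = 0"
      moreover have "0 < 4 ^ m * D\<^sup>2"
        using \<open>D > 0\<close> by simp
      ultimately show False
        using B(5) by simp
    qed
    have "(det B)\<^sup>2 \<le> 2 ^ (d + m) * D\<^sup>2"
      by (rule upper[OF B(1-4)])
    \<comment> \<open>Here \<open>m \<le> d + 2\<close>, so every matrix met before the last step
      satisfies the determinant bound claimed in the lemma, and only the enclosing property can
      fail.\<close>
    also have "\<dots> \<le> 2 ^ (d + (d + 2)) * D\<^sup>2"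
      using Suc.prems by (intro mult_right_mono power_increasing) auto
    also have "\<dots> = (2 ^ (d + 1) * D)\<^sup>2"
      by (simp add: power_mult_distrib power_add power2_eq_square)
    finally have "\<bar>det B\<bar> \<le> \<bar>2 ^ (d + 1) * D\<bar>"
      by (simp only: abs_le_square_iff)
    then have "\<bar>det B\<bar> \<le> 2 ^ (d + 1) * D"
      using \<open>D > 0\<close> by simp
    then obtain u where u: "u \<in> carrier_vec d" "B *\<^sub>v u \<in> K" "u \<bullet> u > 3"
      using neg good[of B] B(1) nz by fastforce
    obtain B' where B': "B' \<in> carrier_mat d d"
      "B' * transpose_mat B' = B * transpose_mat B + 1 \<cdot>\<^sub>m outer d (B *\<^sub>v u)"
      "(det B')\<^sup>2 = (det B)\<^sup>2 * (1 + 1 * (u \<bullet> u))"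
      using rank_one_update[OF B(1) u(1), of 1] u(3) by auto
    have "4 ^ Suc m * D\<^sup>2 = 4 * (4 ^ m * D\<^sup>2)"
      by simp
    also have "\<dots> \<le> 4 * (det B)\<^sup>2 * 4"
      using B(5) by linarith
    also have "\<dots> \<le> 4 * (det B)\<^sup>2 * (1 + 1 * (u \<bullet> u))"
      using u(3) by (intro mult_left_mono) auto
    finally have "4 ^ Suc m * D\<^sup>2 \<le> 4 * (det B')\<^sup>2"
      unfolding B'(3) by simp
    then show ?case
      using B B' u by (intro exI[of _ B'] exI[of _ "B *\<^sub>v u # xs"]) (simp add: gram_Cons)
  qed
  \<comment> \<open>In units of \<open>4 ^ d * D\<^sup>2\<close>, the growth gives 64 and the upper
    bound 32. With \<open>d + 2\<close> steps both would be 16, without a contradiction.\<close>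
  from this[of "d + 3"] obtain B xs where B: "B \<in> carrier_mat d d" "B * transpose_mat B = gram d xs" "set xs \<subseteq> K"
      "length xs = d + (d + 3)" "4 ^ (d + 3) * D\<^sup>2 \<le> 4 * (det B)\<^sup>2"
    by auto
  define q where "q = (4::real) ^ d * D\<^sup>2"
  have "64 * q = 4 ^ (d + 3) * D\<^sup>2"
    by (simp add: q_def power_add)
  also have "\<dots> \<le> 4 * (2 ^ (d + (d + 3)) * D\<^sup>2)"
    using B(5) upper[OF B(1-4)] by linarith
  also have "\<dots> = 32 * q"
    by (simp add: q_def power_add power_mult flip: mult_2)
  finally show False
    using \<open>D > 0\<close> by (simp add: q_def mult_le_0_iff not_le)
qed

section \<open>Log-concave functions\<close>

text \<open>Log-concavity without infinite exponents: where the function vanishes,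
  \<open>0 powr t = 0\<close> plays the role of the value \<open>\<infinity>\<close> of the convex
  function.\<close>

definition powr_concave :: "nat \<Rightarrow> (real Matrix.vec \<Rightarrow> real) \<Rightarrow> bool" where
  "powr_concave d f \<longleftrightarrow> (\<forall>x\<in>carrier_vec d. 0 \<le> f x) \<and>
    (\<forall>x\<in>carrier_vec d. \<forall>y\<in>carrier_vec d. \<forall>t. 0 < t \<and> t < 1 \<longrightarrow>
      f x powr (1 - t) * f y powr t \<le> f ((1 - t) \<cdot>\<^sub>v x + t \<cdot>\<^sub>v y))"

lemma log_concave_imp_powr_concave:
  assumes "log_concave d f"
  shows "powr_concave d f"
proof -
  obtain \<phi> where \<phi>: "convex_function d \<phi>"
    and f: "\<And>x. x \<in> carrier_vec d \<Longrightarrow> f x = (if \<phi> x = \<infinity> then 0 else exp (- real_of_ereal (\<phi> x)))"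
    using assms unfolding log_concave_def by auto
  show ?thesis
    unfolding powr_concave_def
  proof (intro conjI ballI allI impI)
    fix x y :: "real Matrix.vec" and t :: real
  assume x: "x \<in> carrier_vec d" and y: "y \<in> carrier_vec d" and t: "0 < t \<and> t < 1"
    let ?z = "(1 - t) \<cdot>\<^sub>v x + t \<cdot>\<^sub>v y"
    have z: "?z \<in> carrier_vec d" using x y by simp
    have fin: "\<phi> x \<noteq> -\<infinity>" "\<phi> y \<noteq> -\<infinity>" "\<phi> ?z \<noteq> -\<infinity>"
      using \<phi> x y z by (auto simp: convex_function_def)
    have conv: "\<phi> ?z \<le> ereal (1 - t) * \<phi> x + ereal t * \<phi> y"
      using \<phi> x y t unfolding convex_function_def by blast
    show "f x powr (1 - t) * f y powr t \<le> f ?z"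
    proof (cases "\<phi> x = \<infinity> \<or> \<phi> y = \<infinity>")
      case True
      then show ?thesis using f[OF x] f[OF y] f[OF z] by auto
    next
      case False
      then obtain a b where ab: "\<phi> x = ereal a" "\<phi> y = ereal b"
        using fin by (metis ereal_cases)
      then have le: "\<phi> ?z \<le> ereal ((1 - t) * a + t * b)"
        using conv by simp
      then obtain c where c: "\<phi> ?z = ereal c"
        using fin by (cases "\<phi> ?z") auto
      have "f x powr (1 - t) * f y powr t = exp (- ((1 - t) * a + t * b))"
        using f[OF x] f[OF y] ab by (simp add: powr_def exp_add[symmetric] algebra_simps)
      also have "\<dots> \<le> f ?z"
        using f[OF z] le c by simp
      finally show ?thesis .
    qed
  qed (use f in auto)
qed

lemma powr_concave_nonneg: "powr_concave d f \<Longrightarrow> x \<in> carrier_vec d \<Longrightarrow> 0 \<le> f x"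
  by (simp add: powr_concave_def)

lemma powr_concaveD:
  "powr_concave d f \<Longrightarrow> x \<in> carrier_vec d \<Longrightarrow> y \<in> carrier_vec d \<Longrightarrow> 0 < t \<Longrightarrow> t < 1 \<Longrightarrow>
    f x powr (1 - t) * f y powr t \<le> f ((1 - t) \<cdot>\<^sub>v x + t \<cdot>\<^sub>v y)"
  by (simp add: powr_concave_def)

lemma powr_concave_level:
  assumes f: "powr_concave d f" and xy: "x \<in> carrier_vec d" "y \<in> carrier_vec d"
    and t: "0 \<le> t" "t \<le> 1" and c: "0 < c" "c \<le> f x" "c \<le> f y"
  shows "c \<le> f ((1 - t) \<cdot>\<^sub>v x + t \<cdot>\<^sub>v y)"
proof -
  consider "t = 0" | "t = 1" | "0 < t" "t < 1" using t by linarith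
  then show ?thesis
  proof cases
    case 3
    have "c = c powr (1 - t) * c powr t"
      using c by (simp add: powr_add[symmetric])
    also have "\<dots> \<le> f x powr (1 - t) * f y powr t"
      using c 3 by (intro mult_mono powr_mono2) auto
    also have "\<dots> \<le> f ((1 - t) \<cdot>\<^sub>v x + t \<cdot>\<^sub>v y)"
      by (rule powr_concaveD[OF f xy 3])
    finally show ?thesis .
  next
    case 1
    have "(1 - t) \<cdot>\<^sub>v x + t \<cdot>\<^sub>v y = x"
      using xy 1 by (intro eq_vecI) auto
    then show ?thesis using c by simp
  next
    case 2
    have "(1 - t) \<cdot>\<^sub>v x + t \<cdot>\<^sub>v y = y"
      using xy 2 by (intro eq_vecI) auto
    then show ?thesis using c by simp
  qed
qed

lemma powr_concave_shift:
  assumes f: "powr_concave d f" and b: "b \<in> carrier_vec d"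
  shows "powr_concave d (\<lambda>x. f (x + b))"
  unfolding powr_concave_def
proof (intro conjI ballI allI impI)
  fix x y :: "real Matrix.vec" and t :: real
  assume x: "x \<in> carrier_vec d" and y: "y \<in> carrier_vec d" and t: "0 < t \<and> t < 1"
  have "(1 - t) \<cdot>\<^sub>v (x + b) + t \<cdot>\<^sub>v (y + b) = (1 - t) \<cdot>\<^sub>v x + t \<cdot>\<^sub>v y + b"
    using x y b by (intro eq_vecI) (auto simp: algebra_simps)
  then show "f (x + b) powr (1 - t) * f (y + b) powr t \<le> f ((1 - t) \<cdot>\<^sub>v x + t \<cdot>\<^sub>v y + b)"
    using powr_concaveD[OF f, of "x + b" "y + b" t] x y b t by simp
qed (use powr_concave_nonneg[OF f] b in simp)

lemma mult_mat_unit_vec: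
  fixes X :: "real mat"
  assumes "X \<in> carrier_mat n d" "k < d"
  shows "X *\<^sub>v unit_vec d k = col X k"
  using assms by (intro eq_vecI) (auto simp: scalar_prod_right_unit)

text \<open>Superlevel sets are convex, hence contain the simplex spanned by the origin and the
  columns. The induction runs over the number of leading coordinates of \<open>t\<close> that may be
  nonzero and splits off the last vertex.\<close>

lemma powr_concave_simplex:
  assumes f: "powr_concave d f" and X: "X \<in> carrier_mat d d"
    and c: "0 < c" "c \<le> f (0\<^sub>v d)" "\<And>j. j < d \<Longrightarrow> c \<le> f (col X j)"
    and t: "t \<in> carrier_vec d" "\<And>i. i < d \<Longrightarrow> 0 \<le> t $ i" "(\<Sum>i<d. t $ i) \<le> 1"
  shows "c \<le> f (X *\<^sub>v t)"
proof -
  have "c \<le> f (X *\<^sub>v t)"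
    if "k \<le> d" "t \<in> carrier_vec d" "\<And>i. i < d \<Longrightarrow> 0 \<le> t $ i" "(\<Sum>i<d. t $ i) \<le> 1"
      "\<And>i. k \<le> i \<Longrightarrow> i < d \<Longrightarrow> t $ i = 0" for k t
    using that
  proof (induction k arbitrary: t)
    case 0
    have "t = 0\<^sub>v d"
      using 0 by (intro eq_vecI) auto
    moreover have "X *\<^sub>v 0\<^sub>v d = 0\<^sub>v d"
      using X by (intro eq_vecI) auto
    ultimately show ?case using c by simp
  next
    case (Suc k)
    then have k: "k < d" by simp
    define s where "s = t $ k"
    have split: "(\<Sum>i<d. t $ i) = s + (\<Sum>i\<in>{..<d} - {k}. t $ i)"
      using k by (subst sum.remove[of _ k]) (auto simp: s_def)
    have rest: "0 \<le> (\<Sum>i\<in>{..<d} - {k}. t $ i)"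
      using Suc.prems by (intro sum_nonneg) auto
    have s: "0 \<le> s" "s \<le> 1"
      using Suc.prems(3)[OF k] Suc.prems(4) split rest by (auto simp: s_def)
    show ?case
    proof (cases "s = 1")
      case True
      then have "(\<Sum>i\<in>{..<d} - {k}. t $ i) = 0"
        using Suc.prems(4) split rest by simp
      then have "t $ i = 0" if "i < d" "i \<noteq> k" for i
        using that Suc.prems(3) by (subst (asm) sum_nonneg_eq_0_iff) auto
      then have "t = unit_vec d k"
        using True Suc.prems(2) k by (intro eq_vecI) (auto simp: s_def)
      then show ?thesis
        using mult_mat_unit_vec[OF X k] c(3)[OF k] by simp
    next
      case False
      \<comment> \<open>The other weights are rescaled to sum to at most 1 again; the division by
        \<open>1 - s\<close> is the reason for treating \<open>s = 1\<close> apart.\<close>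
      define t' where "t' = vec d (\<lambda>i. if i = k then 0 else t $ i / (1 - s))"
      have t': "t' \<in> carrier_vec d" by (simp add: t'_def)
      have "(\<Sum>i<d. t' $ i) = (\<Sum>i\<in>{..<d} - {k}. t $ i) / (1 - s)"
        using k by (subst sum.remove[of _ k]) (auto simp: t'_def sum_divide_distrib)
      also have "\<dots> \<le> 1"
        using Suc.prems(4) split s False by (simp add: divide_le_eq)
      finally have sum': "(\<Sum>i<d. t' $ i) \<le> 1" .
      have "c \<le> f (X *\<^sub>v t')"
        by (rule Suc.IH[OF _ t' _ sum'])
          (use k s False Suc.prems(3,5) in \<open>auto simp: t'_def\<close>)
      moreover have "c \<le> f (col X k)" by (rule c(3)[OF k])
      ultimately have "c \<le> f ((1 - s) \<cdot>\<^sub>v (X *\<^sub>v t') + s \<cdot>\<^sub>v col X k)"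
        using powr_concave_level[OF f _ _ s c(1)] X t' k by (simp add: carrier_matD)
      also have "(1 - s) \<cdot>\<^sub>v (X *\<^sub>v t') + s \<cdot>\<^sub>v col X k = X *\<^sub>v ((1 - s) \<cdot>\<^sub>v t' + s \<cdot>\<^sub>v unit_vec d k)"
        using X t' k by (simp add: mult_add_distrib_mat_vec[OF X] mult_mat_vec[OF X] mult_mat_unit_vec)
      also have "(1 - s) \<cdot>\<^sub>v t' + s \<cdot>\<^sub>v unit_vec d k = t"
        using Suc.prems(2) k False by (intro eq_vecI) (auto simp: t'_def s_def)
      finally show ?thesis .
    qed
  qed
  from this[OF order.refl t] show ?thesis by simp
qed

section \<open>Volume bounds, nondegenerate simplices and boundedness\<close>

lemma nn_integral_lborel_vec_prod:
  assumes [measurable]: "\<And>i. i < d \<Longrightarrow> f i \<in> borel_measurable borel"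
  shows "(\<integral>\<^sup>+x. (\<Prod>i<d. f i (x $ i)) \<partial>lborel_vec d) = (\<Prod>i<d. \<integral>\<^sup>+x. f i x \<partial>lborel)"
proof -
  interpret product_sigma_finite "\<lambda>_::nat. lborel :: real measure" by standard
  have "(\<lambda>x. f i (x $ i)) \<in> borel_measurable (lborel_vec d)" if "i < d" for i
    using measurable_compose[OF measurable_vec_index[OF that] assms[OF that]] .
  then have "(\<lambda>x. \<Prod>i<d. f i (x $ i)) \<in> borel_measurable (lborel_vec d)"
    by (intro borel_measurable_prod_ennreal) auto
  then have "(\<integral>\<^sup>+x. (\<Prod>i<d. f i (x $ i)) \<partial>lborel_vec d)
      = (\<integral>\<^sup>+x. (\<Prod>i\<in>{..<d}. f i (x i)) \<partial>PiM {..<d} (\<lambda>_. lborel))"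
    by (subst nn_integral_lborel_vec) auto
  also have "\<dots> = (\<Prod>i<d. \<integral>\<^sup>+x. f i x \<partial>lborel)"
    by (rule product_nn_integral_prod) auto
  finally show ?thesis .
qed

text \<open>The cube of side \<open>1 / d\<close> replaces the standard simplex that contains it,
  since its volume is immediate from Fubini. Having \<open>d ^ d\<close> in place of
  \<open>fact d\<close> loses at most a factor \<open>exp d\<close>.\<close>

lemma nn_integral_ge_box:
  assumes d: "d \<ge> 1" and X: "X \<in> carrier_mat d d" "det X \<noteq> 0" and b: "b \<in> carrier_vec d" and c: "c \<ge> 0"
    and f [measurable]: "f \<in> borel_measurable (lborel_vec d)"
    and ge: "\<And>t. t \<in> carrier_vec d \<Longrightarrow> (\<And>i. i < d \<Longrightarrow> 0 \<le> t $ i \<and> t $ i \<le> 1 / real d) \<Longrightarrow> c \<le> f (X *\<^sub>v t + b)"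
  shows "ennreal (c * \<bar>det X\<bar> / real d ^ d) \<le> (\<integral>\<^sup>+x. ennreal (f x) \<partial>lborel_vec d)"
proof -
  define box where "box = (\<lambda>t. \<Prod>i<d. indicator {0..1 / real d} (t $ i) :: ennreal)"
  note measurable_add_vec[OF b, measurable]
  have boxm: "box \<in> borel_measurable (lborel_vec d)"
    unfolding box_def
    by (intro borel_measurable_prod_ennreal measurable_compose[OF measurable_vec_index]) auto
  have "(\<integral>\<^sup>+t. box t \<partial>lborel_vec d) = (\<Prod>i<d. \<integral>\<^sup>+x. indicator {0..1 / real d} x \<partial>lborel)"
    unfolding box_def by (rule nn_integral_lborel_vec_prod) simp
  also have "\<dots> = ennreal (1 / real d ^ d)"
    by (simp add: ennreal_power power_one_over)
  finally have box: "(\<integral>\<^sup>+t. box t \<partial>lborel_vec d) = ennreal (1 / real d ^ d)" .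
  have "ennreal c * box t \<le> ennreal (f (X *\<^sub>v t + b))" if t: "t \<in> carrier_vec d" for t
  proof (cases "\<forall>i<d. 0 \<le> t $ i \<and> t $ i \<le> 1 / real d")
    case True
    then have "box t = 1"
      by (simp add: box_def)
    then show ?thesis
      using ge[OF t] True by (simp add: ennreal_leI)
  next
    case False
    then obtain i where "i < d" "t $ i \<notin> {0..1 / real d}" by auto
    then have "box t = 0"
      unfolding box_def by (intro prod_zero) (auto intro!: bexI[of _ i])
    then show ?thesis by simp
  qed
  then have "(\<integral>\<^sup>+t. ennreal c * box t \<partial>lborel_vec d) \<le> (\<integral>\<^sup>+t. ennreal (f (X *\<^sub>v t + b)) \<partial>lborel_vec d)"
    by (intro nn_integral_mono) simp
  then have "ennreal \<bar>det X\<bar> * (ennreal c * ennreal (1 / real d ^ d))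
      \<le> ennreal \<bar>det X\<bar> * (\<integral>\<^sup>+t. ennreal (f (X *\<^sub>v t + b)) \<partial>lborel_vec d)"
    using boxm by (intro mult_left_mono) (simp_all add: nn_integral_cmult box)
  also have "\<dots> = (\<integral>\<^sup>+x. ennreal (f (x + b)) \<partial>lborel_vec d)"
    using nn_integral_linear[OF X, of "\<lambda>x. ennreal (f (x + b))"] by simp
  also have "\<dots> = (\<integral>\<^sup>+x. ennreal (f x) \<partial>lborel_vec d)"
    using nn_integral_shift[OF b, of "\<lambda>x. ennreal (f x)"] by simp
  finally show ?thesis
    using c by (simp add: ennreal_mult[symmetric] mult.commute)
qed

text \<open>The infinite weight makes this function a majorant of every integrand that vanishes off
  the hyperplane.\<close>

lemma nn_integral_hyperplane:
  assumes k: "k < d"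
  shows "(\<integral>\<^sup>+x. \<infinity> * indicator {0} (x $ k) \<partial>lborel_vec d) = 0"
proof -
  define g where "g = (\<lambda>i x. if i = k then \<infinity> * indicator {0::real} x else (1::ennreal))"
  have "(\<integral>\<^sup>+x. \<infinity> * indicator {0} (x $ k) \<partial>lborel_vec d) = (\<integral>\<^sup>+x. (\<Prod>i<d. g i (x $ i)) \<partial>lborel_vec d)"
    using k by (simp add: g_def)
  also have "\<dots> = (\<Prod>i<d. \<integral>\<^sup>+x. g i x \<partial>lborel)"
    by (rule nn_integral_lborel_vec_prod) (simp add: g_def)
  also have "\<dots> = 0"
    using k by (intro prod_zero) (auto simp: g_def nn_integral_cmult intro!: bexI[of _ k])
  finally show ?thesis .
qed

text \<open>A function of positive integral is not concentrated on a hyperplane. Columns of the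
  identity are replaced one at a time; in the basis of the current columns, the new column
  \<open>X *\<^sub>v u\<close> keeps the determinant nonzero if \<open>u $ k \<noteq> 0\<close>, by
  Cramer's rule.\<close>

lemma columns_in_support:
  assumes [measurable]: "g \<in> borel_measurable (lborel_vec d)" and pos: "(\<integral>\<^sup>+x. g x \<partial>lborel_vec d) > 0"
  obtains X where "X \<in> carrier_mat d d" "det X \<noteq> 0" "\<And>j. j < d \<Longrightarrow> g (col X j) > 0"
proof -
  have "\<exists>X\<in>carrier_mat d d. det X \<noteq> 0 \<and> (\<forall>j<k. g (col X j) > 0)" if "k \<le> d" for k
    using that
  proof (induction k)
    case 0
    then show ?case by (intro bexI[of _ "1\<^sub>m d"]) auto
  next
    case (Suc k)
    then obtain X where X: "X \<in> carrier_mat d d" "det X \<noteq> 0" "\<And>j. j < k \<Longrightarrow> g (col X j) > 0"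
      by auto
    have k: "k < d" using Suc by simp
    have "\<exists>u\<in>carrier_vec d. g (X *\<^sub>v u) > 0 \<and> u $ k \<noteq> 0"
    proof (rule ccontr)
      assume neg: "\<not> ?thesis"
      have "(\<integral>\<^sup>+u. g (X *\<^sub>v u) \<partial>lborel_vec d) \<le> (\<integral>\<^sup>+x. \<infinity> * indicator {0} (x $ k) \<partial>lborel_vec d)"
      proof (rule nn_integral_mono)
        fix u :: "real Matrix.vec" assume "u \<in> space (lborel_vec d)"
        then show "g (X *\<^sub>v u) \<le> \<infinity> * indicator {0} (u $ k)"
          using neg by (cases "u $ k = 0") auto
      qed
      then have "(\<integral>\<^sup>+u. g (X *\<^sub>v u) \<partial>lborel_vec d) = 0"
        unfolding nn_integral_hyperplane[OF k] by simp
      then show False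
        using nn_integral_linear[OF X(1,2), of g] pos by simp
    qed
    then obtain u where u: "u \<in> carrier_vec d" "g (X *\<^sub>v u) > 0" "u $ k \<noteq> 0" by auto
    define Y where "Y = replace_col X (X *\<^sub>v u) k"
    have Y: "Y \<in> carrier_mat d d"
      using X by (auto simp: Y_def replace_col_def)
    have "det Y \<noteq> 0"
      using cramer_lemma_mat[OF X(1) u(1) k] X(2) u(3) by (simp add: Y_def)
    moreover have "g (col Y j) > 0" if "j < Suc k" for j
    proof (cases "j = k")
      case True
      have "col Y k = X *\<^sub>v u"
        using X(1) k by (intro eq_vecI) (auto simp: Y_def replace_col_def)
      then show ?thesis using True u(2) by simp
    next
      case False
      then have "j < k" using that by simp
      moreover have "col Y j = col X j"
        using X(1) k \<open>j < k\<close> by (intro eq_vecI) (auto simp: Y_def replace_col_def)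
      ultimately show ?thesis using X(3) by simp
    qed
    ultimately show ?case using Y by blast
  qed
  from this[of d] that show thesis by auto
qed

text \<open>A quantitative form of nondegeneracy, with one positive lower bound at all vertices of a
  full-dimensional simplex. It serves both the boundedness of \<open>f\<close> and the compactness
  of the set of admissible majorants.\<close>

lemma support_simplex:
  assumes f: "powr_concave d f" and [measurable]: "f \<in> borel_measurable (lborel_vec d)"
    and pos: "(\<integral>\<^sup>+x. ennreal (f x) \<partial>lborel_vec d) > 0"
  obtains y X e where "y \<in> carrier_vec d" "X \<in> carrier_mat d d" "det X \<noteq> 0" "e > 0" "e \<le> f y"
    "\<And>j. j < d \<Longrightarrow> e \<le> f (col X j + y)"
proof -
  have "\<exists>y\<in>carrier_vec d. f y > 0"
  proof (rule ccontr)
    assume "\<not> ?thesis"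
    then have "(\<integral>\<^sup>+x. ennreal (f x) \<partial>lborel_vec d) = (\<integral>\<^sup>+x. 0 \<partial>lborel_vec d)"
      by (intro nn_integral_cong) (auto simp: not_less ennreal_neg)
    then show False using pos by simp
  qed
  then obtain y where y: "y \<in> carrier_vec d" "f y > 0" by auto
  note measurable_add_vec[OF y(1), measurable]
  have "(\<integral>\<^sup>+x. ennreal (f (x + y)) \<partial>lborel_vec d) > 0"
    using pos nn_integral_shift[OF y(1), of "\<lambda>x. ennreal (f x)"] by simp
  from columns_in_support[OF _ this]
  obtain X where X: "X \<in> carrier_mat d d" "det X \<noteq> 0" "\<And>j. j < d \<Longrightarrow> 0 < f (col X j + y)"
    by (auto simp: ennreal_less_zero_iff)
  define e where "e = Min (insert (f y) ((\<lambda>j. f (col X j + y)) ` {..<d}))"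
  have "e > 0"
    unfolding e_def using y X(3) by (subst Min_gr_iff) auto
  moreover have "e \<le> f y" "\<And>j. j < d \<Longrightarrow> e \<le> f (col X j + y)"
    unfolding e_def by (auto intro!: Min_le)
  ultimately show thesis
    using that y X by blast
qed

text \<open>Log-concavity at midpoints gives \<open>f \<ge> sqrt (f z * e)\<close> on the half-size
  copy of a fixed simplex shrunk towards \<open>z\<close>. The volume of this copy does not depend
  on \<open>z\<close>, so the finite integral bounds \<open>f z\<close>.\<close>

lemma powr_concave_bounded:
  assumes d: "d \<ge> 1" and f: "powr_concave d f" and fm: "f \<in> borel_measurable (lborel_vec d)"
    and I: "(\<integral>\<^sup>+x. ennreal (f x) \<partial>lborel_vec d) = ennreal I" "I > 0"
  shows "bdd_above (f ` carrier_vec d)"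
proof -
  obtain y X e where y: "y \<in> carrier_vec d" and X: "X \<in> carrier_mat d d" "det X \<noteq> 0" and e: "e > 0"
    "e \<le> f y" "\<And>j. j < d \<Longrightarrow> e \<le> f (col X j + y)"
    using support_simplex[OF f fm] I by auto
  define q where "q = I * real d ^ d / \<bar>det ((1 / 2) \<cdot>\<^sub>m X)\<bar>"
  have "f z \<le> q\<^sup>2 / e" if z: "z \<in> carrier_vec d" for z
  proof -
    let ?b = "(1 / 2) \<cdot>\<^sub>v (z + y)"
    have X2: "(1 / 2) \<cdot>\<^sub>m X \<in> carrier_mat d d" "det ((1 / 2) \<cdot>\<^sub>m X) \<noteq> 0"
      using X by auto
    have "ennreal (sqrt (f z * e) * \<bar>det ((1 / 2) \<cdot>\<^sub>m X)\<bar> / real d ^ d) \<le> (\<integral>\<^sup>+x. ennreal (f x) \<partial>lborel_vec d)"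
    proof (rule nn_integral_ge_box[OF d X2 _ _ fm])
      fix t assume t: "t \<in> carrier_vec d" "\<And>i. i < d \<Longrightarrow> 0 \<le> t $ i \<and> t $ i \<le> 1 / real d"
      have "(\<Sum>i<d. t $ i) \<le> (\<Sum>i<d. 1 / real d)"
        using t by (intro sum_mono) auto
      then have "e \<le> f (X *\<^sub>v t + y)"
        using powr_concave_simplex[OF powr_concave_shift[OF f y] X(1) e(1) _ e(3) t(1)] t d e(2) y by simp
      then have "sqrt (f z * e) \<le> f z powr (1 - 1 / 2) * f (X *\<^sub>v t + y) powr (1 / 2)"
        using powr_concave_nonneg[OF f z] e(1)
        by (simp add: powr_half_sqrt real_sqrt_mult mult_left_mono)
      also have "\<dots> \<le> f ((1 - 1 / 2) \<cdot>\<^sub>v z + (1 / 2) \<cdot>\<^sub>v (X *\<^sub>v t + y))"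
        using X t y z by (intro powr_concaveD[OF f]) auto
      also have "(1 - 1 / 2) \<cdot>\<^sub>v z + (1 / 2) \<cdot>\<^sub>v (X *\<^sub>v t + y) = (1 / 2) \<cdot>\<^sub>m X *\<^sub>v t + ?b"
        using X t y z by (intro eq_vecI) (auto simp: algebra_simps add_divide_distrib)
      finally show "sqrt (f z * e) \<le> f ((1 / 2) \<cdot>\<^sub>m X *\<^sub>v t + ?b)" .
    qed (use y z powr_concave_nonneg[OF f z] e in auto)
    then have "sqrt (f z * e) \<le> q"
      using I X2 d powr_concave_nonneg[OF f z] e(1) by (simp add: q_def field_simps)
    then have "f z * e \<le> q\<^sup>2"
      by (rule sqrt_le_D)
    then show ?thesis
      using e(1) by (simp add: field_simps)
  qed
  then show ?thesis by (intro bdd_aboveI2[of _ _ "q\<^sup>2 / e"]) auto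
qed

section \<open>Exponential majorants of log-concave functions\<close>

lemma scalar_prod_self_nonneg: "0 \<le> (x :: real Matrix.vec) \<bullet> x"
  by (auto simp: scalar_prod_def intro!: sum_nonneg)

text \<open>The constant collects \<open>exp (2 * d)\<close> from the prefactor needed inside the
  ellipsoid, \<open>exp (3 * d)\<close> from the level, and \<open>2 ^ (d + 1) \<le> 4 ^ d\<close>
  from the determinant of the ellipsoid.\<close>

theorem exponential_majorant:
  assumes d: "d \<ge> 1" and f: "powr_concave d f" and fm [measurable]: "f \<in> borel_measurable (lborel_vec d)"
    and I: "(\<integral>\<^sup>+x. ennreal (f x) \<partial>lborel_vec d) = ennreal I" "I > 0"
  obtains A \<alpha> y where "A \<in> carrier_mat d d" "det A \<noteq> 0" "y \<in> carrier_vec d" "\<alpha> > 0"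
    "\<And>x. x \<in> carrier_vec d \<Longrightarrow> f x \<le> \<alpha> * exp (- euclidean_norm (A *\<^sub>v (x - y)))"
    "\<alpha> / \<bar>det A\<bar> \<le> (4 * exp 5) ^ d * I"
proof -
  define m where "m = Sup (f ` carrier_vec d)"
  note bdd = powr_concave_bounded[OF d f fm I]
  have le_m: "f x \<le> m" if "x \<in> carrier_vec d" for x
    unfolding m_def using bdd that by (intro cSup_upper) auto
  have "(\<integral>\<^sup>+x. ennreal (f x) \<partial>lborel_vec d) > 0"
    using I by simp
  from support_simplex[OF f fm this]
  obtain y0 e where "y0 \<in> carrier_vec d" "e > 0" "e \<le> f y0"
    by blast
  then have m: "m > 0"
    using le_m[of y0] by linarith
  \<comment> \<open>A centre within a factor \<open>exp 1\<close> of the supremum suffices: it costs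
    1 in the exponent, and the level \<open>exp (- 3 * d)\<close> leaves room for that.\<close>
  have "m * exp (- 1) < m"
    using m by simp
  then have "\<exists>y\<in>carrier_vec d. m * exp (- 1) < f y"
    using \<open>y0 \<in> carrier_vec d\<close> unfolding m_def
    by (subst (asm) less_cSup_iff) (use bdd in \<open>auto simp: m_def\<close>)
  then obtain y where y: "y \<in> carrier_vec d" "m * exp (- 1) < f y" by auto
  define h where "h x = f (x + y)" for x
  note measurable_add_vec[OF y(1), measurable]
  have h: "powr_concave d h"
    unfolding h_def by (rule powr_concave_shift[OF f y(1)])
  have hm: "h \<in> borel_measurable (lborel_vec d)"
    unfolding h_def by measurable
  have hI: "(\<integral>\<^sup>+x. ennreal (h x) \<partial>lborel_vec d) = ennreal I"
    unfolding h_def using nn_integral_shift[OF y(1), of "\<lambda>x. ennreal (f x)"] I by simp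
  have h_le: "h x \<le> m" if "x \<in> carrier_vec d" for x
    unfolding h_def using that y by (intro le_m) auto
  have h0: "m * exp (- 1) < h (0\<^sub>v d)"
    using y by (simp add: h_def)
  define c where "c = m * exp (- 3 * real d)"
  have c: "c > 0" using m by (simp add: c_def)
  have c_h0: "c \<le> h (0\<^sub>v d)"
  proof -
    have "c \<le> m * exp (- 1)"
      using m d by (simp add: c_def)
    then show ?thesis using h0 by linarith
  qed
  define K where "K = {x \<in> carrier_vec d. c \<le> h x}"
  define S where "S = {\<bar>det X\<bar> | X. X \<in> carrier_mat d d \<and> (\<forall>j<d. col X j \<in> K)}"
  have S_le: "s \<le> real d ^ d * I / c" if s: "s \<in> S" for s
  proof -
    obtain X where X: "X \<in> carrier_mat d d" "\<And>j. j < d \<Longrightarrow> col X j \<in> K" "s = \<bar>det X\<bar>"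
      using s by (auto simp: S_def)
    show ?thesis
    proof (cases "det X = 0")
      case False
      have "ennreal (c * \<bar>det X\<bar> / real d ^ d) \<le> (\<integral>\<^sup>+x. ennreal (h x) \<partial>lborel_vec d)"
      proof (rule nn_integral_ge_box[OF d X(1) False zero_carrier_vec _ hm])
        fix t assume t: "t \<in> carrier_vec d" "\<And>i. i < d \<Longrightarrow> 0 \<le> t $ i \<and> t $ i \<le> 1 / real d"
        have "(\<Sum>i<d. t $ i) \<le> (\<Sum>i<d. 1 / real d)"
          using t by (intro sum_mono) auto
        then have "c \<le> h (X *\<^sub>v t)"
          using X(2) t d by (intro powr_concave_simplex[OF h X(1) c c_h0]) (auto simp: K_def)
        moreover have "X *\<^sub>v t + 0\<^sub>v d = X *\<^sub>v t"
          using X(1) t by simp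
        ultimately show "c \<le> h (X *\<^sub>v t + 0\<^sub>v d)" by simp
      qed (use c in simp)
      then show ?thesis
        unfolding hI X(3) using c d I(2) by (simp add: field_simps)
    qed (use X(3) c d I in simp)
  qed
  then have bddS: "bdd_above S" by (rule bdd_aboveI)
  define D where "D = Sup S"
  have "\<bar>det (0\<^sub>m d d :: real mat)\<bar> \<in> S"
    using c_h0 by (force simp: S_def K_def)
  then have S_ne: "S \<noteq> {}" by blast
  have D_le: "D \<le> real d ^ d * I / c"
    unfolding D_def using S_le S_ne by (intro cSup_least) auto
  \<comment> \<open>Independent points of the support need not lie in \<open>K\<close>. Contracting
    them towards the origin, where \<open>h\<close> is almost maximal, raises their values to at
    least \<open>m * exp (- 2)\<close>.\<close>
  have "D > 0"
  proof -
    have "(\<integral>\<^sup>+x. ennreal (h x) \<partial>lborel_vec d) > 0"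
      using hI I by simp
    from columns_in_support[OF _ this]
    obtain X where X: "X \<in> carrier_mat d d" "det X \<noteq> 0" "\<And>j. j < d \<Longrightarrow> 0 < h (col X j)"
      using hm by (auto simp: ennreal_less_zero_iff)
    define p where "p = Min ((\<lambda>j. h (col X j)) ` {..<d}) / m"
    have p_le: "p * m \<le> h (col X j)" if "j < d" for j
      using m that by (simp add: p_def)
    have "p > 0"
      unfolding p_def using m X(3) d by (intro divide_pos_pos) (auto simp: lessThan_empty_iff)
    have "p * m \<le> m"
      using p_le[of 0] h_le[of "col X 0"] X(1) d by (simp add: carrier_vecI)
    then have "p \<le> 1" using m by simp
    \<comment> \<open>Chosen so that \<open>p powr t \<ge> exp (- 1)\<close>; the 2 in the
      denominator keeps \<open>t < 1\<close> even when \<open>p = 1\<close>.\<close>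
    define t where "t = 1 / (2 - ln p)"
    have lnp: "ln p \<le> 0" using \<open>p > 0\<close> \<open>p \<le> 1\<close> by simp
    have t: "0 < t" "t < 1" using lnp by (auto simp: t_def)
    have "t * ln p \<ge> - 1"
      using lnp by (simp add: t_def field_simps)
    then have pt: "p powr t \<ge> exp (- 1)"
      using \<open>p > 0\<close> by (simp add: powr_def)
    have inK: "col (t \<cdot>\<^sub>m X) j \<in> K" if j: "j < d" for j
    proof -
      have cj: "col X j \<in> carrier_vec d" using X(1) j by auto
      have "c \<le> m * exp (- 2)"
        using m d by (simp add: c_def)
      also have "\<dots> = (m * exp (- 1)) * exp (- 1)"
        by (simp flip: exp_add)
      also have "\<dots> \<le> (m * exp (- 1)) powr (1 - t) * (p * m) powr t"
      proof -
        have "exp (- 1) * exp (- 1) \<le> exp (- 1) powr (1 - t) * p powr t"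
          using pt t by (intro mult_mono) (auto simp: powr_def)
        then have "m * (exp (- 1) * exp (- 1)) \<le> m * (exp (- 1) powr (1 - t) * p powr t)"
          using m by (intro mult_left_mono) auto
        also have "\<dots> = (m * exp (- 1)) powr (1 - t) * (p * m) powr t"
        proof -
          have "m powr (1 - t) * m powr t = m"
            using m by (simp add: powr_add[symmetric])
          moreover have "(m * exp (- 1)) powr (1 - t) = m powr (1 - t) * exp (- 1) powr (1 - t)"
            by (rule powr_mult)
          moreover have "(p * m) powr t = p powr t * m powr t"
            by (rule powr_mult)
          ultimately show ?thesis
            by (metis mult.assoc mult.commute)
        qed
        finally show ?thesis
          by (simp only: mult.assoc)
      qed
      also have "\<dots> \<le> h (0\<^sub>v d) powr (1 - t) * h (col X j) powr t"
        using h0 p_le[OF j] t m \<open>p > 0\<close> by (intro mult_mono powr_mono2) auto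
      also have "\<dots> \<le> h ((1 - t) \<cdot>\<^sub>v 0\<^sub>v d + t \<cdot>\<^sub>v col X j)"
        using cj t by (intro powr_concaveD[OF h]) auto
      also have "(1 - t) \<cdot>\<^sub>v 0\<^sub>v d + t \<cdot>\<^sub>v col X j = col (t \<cdot>\<^sub>m X) j"
        using X(1) j by (intro eq_vecI) auto
      finally show ?thesis
        using X(1) j by (auto simp: K_def)
    qed
    have "\<bar>det (t \<cdot>\<^sub>m X)\<bar> \<in> S"
      unfolding S_def using X(1) inK by (intro CollectI exI[of _ "t \<cdot>\<^sub>m X"]) simp
    then have "\<bar>det (t \<cdot>\<^sub>m X)\<bar> \<le> D"
      unfolding D_def using bddS by (intro cSup_upper)
    moreover have "\<bar>det (t \<cdot>\<^sub>m X)\<bar> > 0"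
      using X t by simp
    ultimately show ?thesis by linarith
  qed
  have "\<exists>s\<in>S. D / 2 < s"
    using \<open>D > 0\<close> bddS S_ne unfolding D_def by (subst less_cSup_iff[symmetric]) auto
  then obtain X where X: "X \<in> carrier_mat d d" "\<And>j. j < d \<Longrightarrow> col X j \<in> K" "D / 2 \<le> \<bar>det X\<bar>"
    by (auto simp: S_def)
  have D_upper: "\<bar>det X\<bar> \<le> D" if "X \<in> carrier_mat d d" "\<And>j. j < d \<Longrightarrow> col X j \<in> K" for X
    unfolding D_def by (rule cSup_upper[OF _ bddS]) (use that in \<open>auto simp: S_def\<close>)
  have "K \<subseteq> carrier_vec d" by (auto simp: K_def)
  from enclosing_ellipsoid[OF this D_upper \<open>D > 0\<close> X]
  obtain B where B: "B \<in> carrier_mat d d" "det B \<noteq> 0" "\<bar>det B\<bar> \<le> 2 ^ (d + 1) * D"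
    "\<And>u. u \<in> carrier_vec d \<Longrightarrow> B *\<^sub>v u \<in> K \<Longrightarrow> u \<bullet> u \<le> 3"
    by metis
  obtain C where C: "C \<in> carrier_mat d d" "B * C = 1\<^sub>m d" "C * B = 1\<^sub>m d" "det C = 1 / det B"
    using inverse_matE[OF B(1,2)] by metis
  have out: "h x < c" if "x \<in> carrier_vec d" "(C *\<^sub>v x) \<bullet> (C *\<^sub>v x) > 3" for x
  proof (rule ccontr)
    assume "\<not> ?thesis"
    then have "x \<in> K" using that by (simp add: K_def)
    moreover have "B *\<^sub>v (C *\<^sub>v x) = x"
      using B(1) C that(1) by (simp flip: assoc_mult_mat_vec)
    ultimately show False
      using B(4)[of "C *\<^sub>v x"] that C(1) by simp
  qed
  have decay: "h x \<le> m * exp (2 * real d) * exp (- real d * euclidean_norm (C *\<^sub>v x))"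
    if x: "x \<in> carrier_vec d" for x
  proof -
    define r where "r = euclidean_norm (C *\<^sub>v x)"
    show ?thesis
    proof (cases "r \<le> 2")
      \<comment> \<open>Up to radius 2 the trivial bound \<open>m\<close> is enough, because the
        prefactor \<open>exp (2 * d)\<close> compensates the exponential there.\<close>
      case True
      have "h x \<le> m" by (rule h_le[OF x])
      also have "\<dots> \<le> m * exp (2 * real d - real d * r)"
        using m mult_left_mono[OF True, of "real d"] by simp
      also have "\<dots> = m * exp (2 * real d) * exp (- real d * r)"
        by (simp add: exp_diff exp_minus field_simps)
      finally show ?thesis by (simp add: r_def)
    next
      case False
      show ?thesis
      proof (cases "h x = 0")
        case True
        then show ?thesis using m by simp
      next
        case nz: False
        then have hx: "h x > 0" using powr_concave_nonneg[OF h x] by simp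
        \<comment> \<open>\<open>t \<cdot>\<^sub>v x\<close> is the point at radius 2 on the segment
          from the origin to \<open>x\<close>. Its squared radius 4 exceeds 3, so \<open>h\<close>
          has fallen below \<open>c\<close> there. Relative to the supremum the drop is at least
          \<open>3 * d - 1 \<ge> 2 * d\<close> in the logarithm over radius 2, which gives rate
          \<open>d\<close>.\<close>
        define t where "t = 2 / r"
        have t: "0 < t" "t < 1" using False by (auto simp: t_def)
        have "C *\<^sub>v (t \<cdot>\<^sub>v x) = t \<cdot>\<^sub>v (C *\<^sub>v x)"
          by (rule mult_mat_vec[OF C(1) x])
        then have "(C *\<^sub>v (t \<cdot>\<^sub>v x)) \<bullet> (C *\<^sub>v (t \<cdot>\<^sub>v x)) = t * t * ((C *\<^sub>v x) \<bullet> (C *\<^sub>v x))"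
          using C(1) by (simp add: scalar_prod_def sum_distrib_left ac_simps)
        also have "(C *\<^sub>v x) \<bullet> (C *\<^sub>v x) = r * r"
          unfolding r_def euclidean_norm_def using scalar_prod_self_nonneg[of "C *\<^sub>v x"] by simp
        also have "t * t * (r * r) = 4"
          using False by (simp add: t_def)
        finally have "h (t \<cdot>\<^sub>v x) < c"
          using out[of "t \<cdot>\<^sub>v x"] x by simp
        moreover have "(1 - t) \<cdot>\<^sub>v 0\<^sub>v d + t \<cdot>\<^sub>v x = t \<cdot>\<^sub>v x"
          using x by (intro eq_vecI) auto
        ultimately have "h (0\<^sub>v d) powr (1 - t) * h x powr t < c"
          using powr_concaveD[OF h zero_carrier_vec x t] by simp
        moreover have h0p: "h (0\<^sub>v d) > 0" using h0 m by (smt (verit) exp_gt_zero mult_pos_pos)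
        ultimately have "ln (h (0\<^sub>v d) powr (1 - t) * h x powr t) < ln c"
          using hx c by (intro ln_less_cancel_iff[THEN iffD2] mult_pos_pos) auto
        then have "(1 - t) * ln (h (0\<^sub>v d)) + t * ln (h x) < ln m - 3 * real d"
          using hx h0p m by (simp add: ln_mult ln_powr c_def)
        moreover have "(1 - t) * (ln m - 1) \<le> (1 - t) * ln (h (0\<^sub>v d))"
        proof (rule mult_left_mono)
          have "ln (m * exp (- 1)) \<le> ln (h (0\<^sub>v d))"
            using h0 m h0p by simp
          then show "ln m - 1 \<le> ln (h (0\<^sub>v d))"
            using m by (simp add: ln_mult)
        qed (use t in simp)
        moreover have "real d \<ge> 1" using d by simp
        ultimately have "t * (ln (h x) - ln m) < - 2 * real d"
          using t by (simp add: algebra_simps)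
        then have "2 * (ln (h x) - ln m) < - 2 * real d * r"
          using False by (simp add: t_def field_simps)
        then have "ln (h x) < ln m - real d * r"
          by simp
        then have "h x < exp (ln m - real d * r)"
          using hx by (metis exp_less_cancel_iff exp_ln)
        also have "\<dots> = m * exp (- real d * r)"
          using m by (simp add: exp_diff exp_minus field_simps)
        also have "\<dots> \<le> m * exp (2 * real d) * exp (- real d * r)"
          using m by simp
        finally show ?thesis by (simp add: r_def)
      qed
    qed
  qed
  \<comment> \<open>The rate \<open>d\<close> is absorbed into the matrix; the resulting
    \<open>d ^ d\<close> in \<open>det A\<close> cancels the one in the bound on
    \<open>D\<close>.\<close>
  define A where "A = real d \<cdot>\<^sub>m C"
  have A: "A \<in> carrier_mat d d" "det A = real d ^ d / det B"
    using C by (simp_all add: A_def carrier_matD)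
  show thesis
  proof (rule that[OF A(1) _ y(1)])
    show "det A \<noteq> 0" using A(2) B(2) d by simp
    show "0 < m * exp (2 * real d)" using m by simp
    show "f x \<le> m * exp (2 * real d) * exp (- euclidean_norm (A *\<^sub>v (x - y)))" if x: "x \<in> carrier_vec d" for x
    proof -
      have "A *\<^sub>v (x - y) = real d \<cdot>\<^sub>v (C *\<^sub>v (x - y))"
        using C(1) x y by (intro eq_vecI) (auto simp: A_def)
      then have "euclidean_norm (A *\<^sub>v (x - y)) = real d * euclidean_norm (C *\<^sub>v (x - y))"
        using C(1) x y by (simp add: euclidean_norm_def real_sqrt_mult)
      moreover have "x - y + y = x"
        using x y by (intro eq_vecI) auto
      ultimately show ?thesis
        using decay[of "x - y"] x y by (simp add: h_def)
    qed
    have "m * exp (2 * real d) / \<bar>det A\<bar> = m * exp (2 * real d) * \<bar>det B\<bar> / real d ^ d"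
      using A(2) B(2) by (simp add: abs_divide)
    also have "\<dots> \<le> m * exp (2 * real d) * (2 ^ (d + 1) * (real d ^ d * I / c)) / real d ^ d"
    proof (intro divide_right_mono mult_left_mono)
      show "\<bar>det B\<bar> \<le> 2 ^ (d + 1) * (real d ^ d * I / c)"
        using B(3) D_le by (meson mult_left_mono order_trans zero_le_numeral zero_le_power)
    qed (use m in auto)
    also have "\<dots> = exp (5 * real d) * 2 ^ (d + 1) * I"
      using m d by (simp add: c_def field_simps flip: exp_add)
    also have "\<dots> \<le> exp (5 * real d) * 4 ^ d * I"
    proof (intro mult_right_mono mult_left_mono)
      have "(2::real) ^ (d + 1) \<le> 2 ^ (2 * d)"
        using d by (intro power_increasing) auto
      then show "(2::real) ^ (d + 1) \<le> 4 ^ d"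
        by (simp add: power_mult)
    qed (use I in auto)
    also have "\<dots> = (4 * exp 5) ^ d * I"
      by (simp add: power_mult_distrib exp_of_nat_mult[symmetric] mult.commute)
    finally show "m * exp (2 * real d) / \<bar>det A\<bar> \<le> (4 * exp 5) ^ d * I" .
  qed
qed

section \<open>The functions \<open>psi\<close>\<close>

lemma euclidean_norm_eq: "x \<in> carrier_vec d \<Longrightarrow> euclidean_norm x = sqrt (\<Sum>i<d. (x $ i)\<^sup>2)"
  by (simp add: euclidean_norm_def scalar_prod_def power2_eq_square atLeast0LessThan)

lemma euclidean_norm_nonneg: "0 \<le> euclidean_norm x"
  by (simp add: euclidean_norm_def scalar_prod_self_nonneg)

lemma measurable_euclidean_norm: "euclidean_norm \<in> borel_measurable (lborel_vec d)"
proof -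
  have [measurable]: "(\<lambda>x. x $ i) \<in> borel_measurable (lborel_vec d)" if "i \<in> {..<d}" for i
    using that by (intro measurable_vec_index) simp
  have "(\<lambda>x. sqrt (\<Sum>i\<in>{..<d}. (x $ i)\<^sup>2)) \<in> borel_measurable (lborel_vec d)"
    by measurable
  then show ?thesis
    by (rule measurable_cong[THEN iffD1, rotated]) (simp add: euclidean_norm_eq)
qed

lemma abs_index_le_euclidean_norm:
  assumes "x \<in> carrier_vec d" "i < d"
  shows "\<bar>x $ i\<bar> \<le> euclidean_norm x"
proof -
  have "(x $ i)\<^sup>2 \<le> (\<Sum>i<d. (x $ i)\<^sup>2)"
    using assms by (intro member_le_sum) auto
  then show ?thesis
    unfolding euclidean_norm_eq[OF assms(1)] by (intro real_le_rsqrt) simp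
qed

lemma sum_abs_le_euclidean_norm:
  assumes "x \<in> carrier_vec d"
  shows "(\<Sum>i<d. \<bar>x $ i\<bar>) \<le> sqrt (real d) * euclidean_norm x"
proof -
  have "(\<Sum>i<d. \<bar>x $ i\<bar>)\<^sup>2 \<le> (\<Sum>i<d. \<bar>x $ i\<bar>\<^sup>2) * real (card {..<d})"
    by (rule sum_squared_le_sum_of_squares)
  then have "(\<Sum>i<d. \<bar>x $ i\<bar>) \<le> sqrt ((\<Sum>i<d. (x $ i)\<^sup>2) * real d)"
    by (intro real_le_rsqrt) simp
  then show ?thesis
    by (simp add: euclidean_norm_eq[OF assms] real_sqrt_mult mult.commute)
qed

lemma sqrt_one_plus_square:
  fixes u :: real
  assumes "u \<ge> 0"
  shows "1 \<le> sqrt (1 + 4 * u\<^sup>2)" "2 * u \<le> sqrt (1 + 4 * u\<^sup>2)" "sqrt (1 + 4 * u\<^sup>2) \<le> 1 + 2 * u"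
proof -
  show "2 * u \<le> sqrt (1 + 4 * u\<^sup>2)"
    by (rule real_le_rsqrt) (simp add: power_mult_distrib)
  have "1 + 4 * u\<^sup>2 \<le> (1 + 2 * u)\<^sup>2"
    using assms by (simp add: power2_eq_square algebra_simps)
  then show "sqrt (1 + 4 * u\<^sup>2) \<le> 1 + 2 * u"
    using assms by (intro real_le_lsqrt) auto
qed simp

lemma psi_le:
  assumes "s \<ge> 0" "t \<ge> 0"
  shows "psi s t \<le> t"
proof (cases "s = 0")
  case False
  then have s: "s > 0" using assms by simp
  define w where "w = sqrt (1 + 4 * (t / s)\<^sup>2)"
  have w: "1 \<le> w" "w \<le> 1 + 2 * (t / s)"
    unfolding w_def using sqrt_one_plus_square[of "t / s"] assms s by auto
  have "0 \<le> ln ((1 + w) / 2)"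
    using w by (intro ln_ge_zero) auto
  then have "s / 2 * (w - ln ((1 + w) / 2) - 1) \<le> s / 2 * (2 * (t / s))"
    using w s by (intro mult_left_mono) linarith+
  then show ?thesis
    using s by (simp add: psi_def flip: w_def)
qed (simp add: psi_def)

text \<open>Applying \<open>ln x \<le> x - 1\<close> at \<open>(1 + w) / 2\<close> shows that the
  logarithm uses up at most half of \<open>w - 1\<close>. Then \<open>w \<ge> 2 * u\<close> gives
  the linear growth and \<open>w \<ge> 1\<close> the sign.\<close>

lemma psi_ge:
  assumes "s \<ge> 0" "t \<ge> 0"
  shows "t / 2 - s / 4 \<le> psi s t" "0 \<le> psi s t"
proof -
  have "t / 2 - s / 4 \<le> psi s t \<and> 0 \<le> psi s t"
  proof (cases "s = 0")
    case False
    then have s: "s > 0" using assms by simp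
    define u where "u = t / s"
    define w where "w = sqrt (1 + 4 * u\<^sup>2)"
    define l where "l = ln ((1 + w) / 2)"
    have w: "1 \<le> w" "2 * u \<le> w"
      unfolding w_def u_def using sqrt_one_plus_square[of "t / s"] assms s by auto
    have "l \<le> (1 + w) / 2 - 1"
      unfolding l_def using w(1) by (intro ln_le_minus_one) simp
    then have le: "(w - 1) / 2 \<le> w - l - 1"
      by (simp add: field_simps)
    have psi: "psi s t = s / 2 * (w - l - 1)"
      using s by (simp add: psi_def flip: u_def w_def l_def)
    have "(2 * u - 1) / 2 \<le> w - l - 1" "0 \<le> w - l - 1" "0 \<le> s / 2"
      using le w s by auto
    then have "s / 2 * ((2 * u - 1) / 2) \<le> psi s t" "s / 2 * 0 \<le> psi s t"
      unfolding psi by (blast intro: mult_left_mono)+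
    moreover have "s / 2 * ((2 * u - 1) / 2) = t / 2 - s / 4"
      using s by (simp add: u_def field_simps)
    ultimately show ?thesis by simp
  qed (use assms in \<open>simp add: psi_def\<close>)
  then show "t / 2 - s / 4 \<le> psi s t" "0 \<le> psi s t" by auto
qed

lemma isCont_psi: "isCont (psi s) t"
proof (cases "s = 0")
  case False
  have "1 + sqrt (1 + 4 * (t / s)\<^sup>2) \<noteq> 0"
    by (smt (verit) real_sqrt_ge_zero zero_le_power2)
  then have "isCont (\<lambda>t. s / 2 * (sqrt (1 + 4 * (t / s)\<^sup>2) - ln ((1 + sqrt (1 + 4 * (t / s)\<^sup>2)) / 2) - 1)) t"
    using False by (intro continuous_intros) auto
  then show ?thesis
    using False by (simp add: psi_def[abs_def])
qed (simp add: psi_def[abs_def])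

lemma measurable_psi [measurable]: "psi s \<in> borel_measurable borel"
  by (intro borel_measurable_continuous_onI continuous_at_imp_continuous_on) (simp add: isCont_psi)

section \<open>Integrals of ellipsoidal functions\<close>

lemma nn_integral_exp_abs_le:
  assumes a: "a > 0"
  shows "(\<integral>\<^sup>+x. ennreal (exp (- a * \<bar>x\<bar>)) \<partial>lborel) \<le> ennreal (2 / a)"
proof -
  let ?f = "\<lambda>x::real. ennreal (exp (- a * x)) * indicator {0..} x"
  have half: "(\<integral>\<^sup>+x. ?f x \<partial>lborel) = ennreal (1 / a)"
  proof -
    have "(\<integral>\<^sup>+x. ?f x \<partial>lborel) = ennreal (0 - (- exp (- a * 0) / a))"
    proof (rule nn_integral_FTC_atLeast)
      show "((\<lambda>x. - exp (- a * x) / a) has_real_derivative exp (- a * x)) (at x)" for x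
        using a by (auto intro!: derivative_eq_intros)
      show "((\<lambda>x. - exp (- a * x) / a) \<longlongrightarrow> 0) at_top"
        using a by real_asymp
    qed auto
    then show ?thesis by simp
  qed
  have refl: "(\<integral>\<^sup>+x. ?f (- x) \<partial>lborel) = (\<integral>\<^sup>+x. ?f x \<partial>lborel)"
    using nn_integral_real_affine[of ?f "- 1" 0] by simp
  \<comment> \<open>Only an inequality holds pointwise, as both halves count
    \<open>x = 0\<close>.\<close>
  have "(\<integral>\<^sup>+x. ennreal (exp (- a * \<bar>x\<bar>)) \<partial>lborel) \<le> (\<integral>\<^sup>+x. ?f x + ?f (- x) \<partial>lborel)"
    by (intro nn_integral_mono) (auto simp: indicator_def abs_real_def)
  also have "\<dots> = (\<integral>\<^sup>+x. ?f x \<partial>lborel) + (\<integral>\<^sup>+x. ?f (- x) \<partial>lborel)"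
    by (rule nn_integral_add) measurable
  also have "\<dots> = ennreal (2 / a)"
    using a unfolding refl half by (simp flip: ennreal_plus)
  finally show ?thesis .
qed

text \<open>The integral of the member with identity matrix, centre 0 and height 1. Every other
  member has \<open>\<alpha> / \<bar>det A\<bar>\<close> times this integral, so minimizing the
  integral becomes minimizing that ratio.\<close>

definition psi_mass :: "nat \<Rightarrow> real \<Rightarrow> real" where
  "psi_mass d s = enn2real (\<integral>\<^sup>+x. ennreal (exp (- psi s (euclidean_norm x))) \<partial>lborel_vec d)"

lemma psi_mass_le:
  assumes d: "d \<ge> 1" and s: "s \<ge> 0"
  shows "psi_mass d s \<le> exp (s / 4) * (4 * sqrt (real d)) ^ d"
proof -
  \<comment> \<open>With this rate, the comparison of the two norms turns the sum over coordinates
    into at most half the Euclidean norm, the linear part of the lower bound on \<open>psi\<close>.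
    Each coordinate then integrates to at most \<open>2 / a = 4 * sqrt d\<close>.\<close>
  define a where "a = 1 / (2 * sqrt (real d))"
  have a: "a > 0" using d by (simp add: a_def)
  have pw: "exp (- psi s (euclidean_norm x)) \<le> exp (s / 4) * (\<Prod>i<d. exp (- a * \<bar>x $ i\<bar>))"
    if x: "x \<in> carrier_vec d" for x
  proof -
    have "(\<Sum>i<d. a * \<bar>x $ i\<bar>) \<le> a * (sqrt (real d) * euclidean_norm x)"
      unfolding sum_distrib_left[symmetric]
      using sum_abs_le_euclidean_norm[OF x] a by (intro mult_left_mono) auto
    also have "\<dots> = euclidean_norm x / 2"
      using d by (simp add: a_def)
    finally have "- psi s (euclidean_norm x) \<le> s / 4 + (\<Sum>i<d. - a * \<bar>x $ i\<bar>)"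
      using psi_ge(1)[OF s euclidean_norm_nonneg, of x] by (simp add: sum_negf)
    then have "exp (- psi s (euclidean_norm x)) \<le> exp (s / 4 + (\<Sum>i<d. - a * \<bar>x $ i\<bar>))"
      by simp
    then show ?thesis by (simp add: exp_add exp_sum)
  qed
  have [measurable]: "(\<lambda>x. \<Prod>i<d. ennreal (exp (- a * \<bar>x $ i\<bar>))) \<in> borel_measurable (lborel_vec d)"
  proof (intro borel_measurable_prod_ennreal)
    fix i assume "i \<in> {..<d}"
    then have [measurable]: "(\<lambda>x. x $ i) \<in> borel_measurable (lborel_vec d)"
      by (intro measurable_vec_index) simp
    show "(\<lambda>x. ennreal (exp (- a * \<bar>x $ i\<bar>))) \<in> borel_measurable (lborel_vec d)"
      by measurable
  qed
  have "(\<integral>\<^sup>+x. ennreal (exp (- psi s (euclidean_norm x))) \<partial>lborel_vec d)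
      \<le> (\<integral>\<^sup>+x. ennreal (exp (s / 4)) * (\<Prod>i<d. ennreal (exp (- a * \<bar>x $ i\<bar>))) \<partial>lborel_vec d)"
    by (intro nn_integral_mono)
      (use pw in \<open>auto simp: prod_ennreal ennreal_mult[symmetric] prod_nonneg intro!: ennreal_leI\<close>)
  also have "\<dots> = ennreal (exp (s / 4)) * (\<integral>\<^sup>+x. (\<Prod>i<d. ennreal (exp (- a * \<bar>x $ i\<bar>))) \<partial>lborel_vec d)"
    by (rule nn_integral_cmult) measurable
  also have "(\<integral>\<^sup>+x. (\<Prod>i<d. ennreal (exp (- a * \<bar>x $ i\<bar>))) \<partial>lborel_vec d)
      = (\<Prod>i<d. \<integral>\<^sup>+x. ennreal (exp (- a * \<bar>x\<bar>)) \<partial>lborel)"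
    by (rule nn_integral_lborel_vec_prod) measurable
  also have "\<dots> \<le> (\<Prod>i<d. ennreal (2 / a))"
    using nn_integral_exp_abs_le[OF a] by (simp add: power_mono)
  also have "(\<Prod>i<d. ennreal (2 / a)) = ennreal ((4 * sqrt (real d)) ^ d)"
    using d by (simp add: a_def ennreal_power)
  finally have "(\<integral>\<^sup>+x. ennreal (exp (- psi s (euclidean_norm x))) \<partial>lborel_vec d)
      \<le> ennreal (exp (s / 4) * (4 * sqrt (real d)) ^ d)"
    by (simp add: ennreal_mult mult_left_mono)
  then show ?thesis
    unfolding psi_mass_def by (intro enn2real_leI) auto
qed

lemma integral_ellipsoidal:
  assumes A: "A \<in> carrier_mat d d" "det A \<noteq> 0" and b: "b \<in> carrier_vec d" and \<alpha>: "\<alpha> > 0"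
  shows "(\<integral>x. \<alpha> * exp (- psi s (euclidean_norm (A *\<^sub>v x - b))) \<partial>lborel_vec d)
    = \<alpha> / \<bar>det A\<bar> * psi_mass d s"
proof -
  have mb: "- b \<in> carrier_vec d" using b by simp
  note measurable_euclidean_norm[measurable] measurable_mult_mat_vec[OF A(1), measurable]
    measurable_add_vec[OF mb, measurable]
  let ?G = "\<lambda>x. ennreal (exp (- psi s (euclidean_norm x)))"
  have eq: "A *\<^sub>v x - b = A *\<^sub>v x + - b" if "x \<in> carrier_vec d" for x
    using that A b by (intro eq_vecI) auto
  have lin: "ennreal \<bar>det A\<bar> * (\<integral>\<^sup>+x. ?G (A *\<^sub>v x + - b) \<partial>lborel_vec d) = (\<integral>\<^sup>+x. ?G x \<partial>lborel_vec d)"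
    using nn_integral_linear[OF A, of "\<lambda>x. ?G (x + - b)"] nn_integral_shift[OF mb, of ?G] by simp
  have "(\<integral>x. \<alpha> * exp (- psi s (euclidean_norm (A *\<^sub>v x - b))) \<partial>lborel_vec d)
      = (\<integral>x. \<alpha> * exp (- psi s (euclidean_norm (A *\<^sub>v x + - b))) \<partial>lborel_vec d)"
    by (rule Bochner_Integration.integral_cong[OF refl]) (simp add: eq)
  also have "\<dots> = \<alpha> * (\<integral>x. exp (- psi s (euclidean_norm (A *\<^sub>v x + - b))) \<partial>lborel_vec d)"
    by simp
  also have "(\<integral>x. exp (- psi s (euclidean_norm (A *\<^sub>v x + - b))) \<partial>lborel_vec d)
      = enn2real (\<integral>\<^sup>+x. ?G (A *\<^sub>v x + - b) \<partial>lborel_vec d)"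
    by (rule integral_eq_nn_integral) auto
  also have "\<dots> = psi_mass d s / \<bar>det A\<bar>"
    using arg_cong[OF lin, of enn2real] A(2) by (simp add: enn2real_mult psi_mass_def field_simps)
  finally show ?thesis by simp
qed

lemma invertible_mat_iff_det:
  fixes A :: "real mat"
  assumes A: "A \<in> carrier_mat d d"
  shows "invertible_mat A \<longleftrightarrow> det A \<noteq> 0"
proof
  assume "invertible_mat A"
  then obtain B where "A * B = 1\<^sub>m (dim_row A)" "B * A = 1\<^sub>m (dim_row B)"
    unfolding invertible_mat_def inverts_mat_def by blast
  then have B: "A * B = 1\<^sub>m d" "dim_col B = d" "dim_row B = d"
    using A by (metis carrier_matD(1), metis carrier_matD(1) index_mult_mat(3) index_one_mat(3),
        metis carrier_matD(2) index_mult_mat(3) index_one_mat(3))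
  then have "det A * det B = 1"
    using det_mult[OF A, of B] by (auto intro: carrier_matI)
  then show "det A \<noteq> 0" by auto
next
  assume "det A \<noteq> 0"
  then obtain B where "B \<in> carrier_mat d d" "A * B = 1\<^sub>m d" "B * A = 1\<^sub>m d"
    using inverse_matE[OF A] by metis
  then show "invertible_mat A"
    using A unfolding invertible_mat_def inverts_mat_def by auto
qed

section \<open>Existence of the Loewner function\<close>

text \<open>Bolzano-Weierstrass with one refinement of the subsequence per index. A finite index set
  lets all entries of a matrix, a vector and a scalar converge simultaneously in a dimension that is
  not a type.\<close>

lemma convergent_subsequence_finite:
  fixes h :: "nat \<Rightarrow> 'i \<Rightarrow> real"
  assumes "finite I" "\<And>n i. i \<in> I \<Longrightarrow> \<bar>h n i\<bar> \<le> C"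
  shows "\<exists>r l. strict_mono (r :: nat \<Rightarrow> nat) \<and> (\<forall>i\<in>I. (\<lambda>n. h (r n) i) \<longlonglongrightarrow> l i)"
  using assms
proof (induction I rule: finite_induct)
  case empty
  show ?case by (intro exI[of _ id]) (simp add: strict_mono_def)
next
  case (insert k I)
  then have "\<exists>r l. strict_mono (r :: nat \<Rightarrow> nat) \<and> (\<forall>i\<in>I. (\<lambda>n. h (r n) i) \<longlonglongrightarrow> l i)"
    by simp
  then obtain r :: "nat \<Rightarrow> nat" and l
    where r: "strict_mono r" "\<forall>i\<in>I. (\<lambda>n. h (r n) i) \<longlonglongrightarrow> l i"
    by blast
  have "\<forall>n. h (r n) k \<in> {- C..C}"
  proof
    fix n
    have "\<bar>h (r n) k\<bar> \<le> C"
      using insert.prems[of k "r n"] by simp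
    then show "h (r n) k \<in> {- C..C}" by auto
  qed
  then obtain c q where q: "strict_mono (q :: nat \<Rightarrow> nat)" "((\<lambda>n. h (r n) k) \<circ> q) \<longlonglongrightarrow> c"
    using compact_imp_seq_compact[OF compact_Icc[of "- C" C]] unfolding seq_compact_def by metis
  have "(\<lambda>n. h ((r \<circ> q) n) i) \<longlonglongrightarrow> (l(k := c)) i" if "i \<in> insert k I" for i
  proof (cases "i = k")
    case True
    then show ?thesis using q(2) by (simp add: o_def)
  next
    case False
    then show ?thesis
      using LIMSEQ_subseq_LIMSEQ[OF r(2)[rule_format] q(1), of i] that by (simp add: o_def)
  qed
  then show ?case
    using strict_mono_o[OF r(1) q(1)] by blast
qed

lemma tendsto_det:
  assumes A: "\<And>n. A n \<in> carrier_mat d d" "B \<in> carrier_mat d d"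
    and lim: "\<And>i j. i < d \<Longrightarrow> j < d \<Longrightarrow> (\<lambda>n. A n $$ (i, j)) \<longlonglongrightarrow> (B $$ (i, j) :: real)"
  shows "(\<lambda>n. det (A n)) \<longlonglongrightarrow> det B"
proof -
  have "(\<lambda>n. \<Sum>p\<in>{p. p permutes {0..<d}}. signof p * (\<Prod>i = 0..<d. A n $$ (i, p i)))
      \<longlonglongrightarrow> (\<Sum>p\<in>{p. p permutes {0..<d}}. signof p * (\<Prod>i = 0..<d. B $$ (i, p i)))"
  proof (intro tendsto_sum tendsto_mult tendsto_const tendsto_prod)
    fix p i assume p: "p \<in> {p. p permutes {0..<d}}" and i: "i \<in> {0..<d}"
    then have "p i \<in> {0..<d}"
      by (metis mem_Collect_eq permutes_in_image)
    with i have "i < d" "p i < d"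
      by simp_all
    then show "(\<lambda>n. A n $$ (i, p i)) \<longlonglongrightarrow> B $$ (i, p i)" by (rule lim)
  qed
  then show ?thesis
    unfolding det_def'[OF A(1)] det_def'[OF A(2)] .
qed

text \<open>A crude consequence of the Leibniz formula; only polynomial growth in \<open>C\<close>
  matters, since it will compete with an exponential.\<close>

lemma abs_det_le:
  fixes A :: "real mat"
  assumes A: "A \<in> carrier_mat d d" and bound: "\<And>i j. i < d \<Longrightarrow> j < d \<Longrightarrow> \<bar>A $$ (i, j)\<bar> \<le> C"
  shows "\<bar>det A\<bar> \<le> fact d * C ^ d"
proof -
  have "\<bar>det A\<bar> \<le> (\<Sum>p\<in>{p. p permutes {0..<d}}. \<bar>signof p * (\<Prod>i = 0..<d. A $$ (i, p i))\<bar>)"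
    unfolding det_def'[OF A] by (rule sum_abs)
  also have "\<dots> \<le> (\<Sum>p\<in>{p. p permutes {0..<d}}. C ^ d)"
  proof (rule sum_mono)
    fix p assume p: "p \<in> {p. p permutes {0..<d}}"
    have "\<bar>signof p * (\<Prod>i = 0..<d. A $$ (i, p i))\<bar> = (\<Prod>i = 0..<d. \<bar>A $$ (i, p i)\<bar>)"
      by (simp add: abs_mult abs_prod sign_def)
    also have "\<dots> \<le> (\<Prod>i = 0..<d. C)"
    proof (intro prod_mono conjI)
      fix i assume i: "i \<in> {0..<d}"
      then have "p i \<in> {0..<d}"
        using p by (metis mem_Collect_eq permutes_in_image)
      with i show "\<bar>A $$ (i, p i)\<bar> \<le> C"
        by (intro bound) simp_all
    qed simp
    finally show "\<bar>signof p * (\<Prod>i = 0..<d. A $$ (i, p i))\<bar> \<le> C ^ d" by simp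
  qed
  also have "\<dots> = fact d * C ^ d"
    using card_permutations[of "{0..<d}" d] by simp
  finally show ?thesis .
qed

text \<open>The centre \<open>a\<close> is encoded as \<open>b = A a\<close>. The argument of the
  norm is then affine in the unknowns \<open>A\<close> and \<open>b\<close>, so bounds and limits
  can be taken entrywise; \<open>a\<close> is recovered by inverting \<open>A\<close>.\<close>

definition feasible :: "nat \<Rightarrow> real \<Rightarrow> (real Matrix.vec \<Rightarrow> real) \<Rightarrow> real mat \<Rightarrow> real Matrix.vec \<Rightarrow> real \<Rightarrow> bool" where
  "feasible d s f A b \<alpha> \<longleftrightarrow> A \<in> carrier_mat d d \<and> det A \<noteq> 0 \<and> b \<in> carrier_vec d \<and> \<alpha> > 0 \<and>
    (\<forall>x\<in>carrier_vec d. f x \<le> \<alpha> * exp (- psi s (euclidean_norm (A *\<^sub>v x - b))))"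

text \<open>A majorant that is at least \<open>e\<close> at \<open>x\<close> has \<open>psi\<close>
  at most \<open>ln (\<alpha> / e)\<close> there, and the linear lower bound on \<open>psi\<close>
  turns this into a bound on the norm.\<close>

lemma feasible_norm_le:
  assumes F: "feasible d s f A b \<alpha>" and s: "s \<ge> 0" and x: "x \<in> carrier_vec d" and e: "e > 0" "e \<le> f x"
  shows "e \<le> \<alpha>" "euclidean_norm (A *\<^sub>v x - b) \<le> 2 * ln (\<alpha> / e) + s / 2"
proof -
  let ?r = "euclidean_norm (A *\<^sub>v x - b)"
  have \<alpha>: "\<alpha> > 0" using F by (simp add: feasible_def)
  have le: "e \<le> \<alpha> * exp (- psi s ?r)"
    using F x e(2) unfolding feasible_def by (meson order_trans)
  also have "\<dots> \<le> \<alpha> * 1"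
    using psi_ge(2)[OF s euclidean_norm_nonneg] \<alpha> by (intro mult_left_mono) auto
  finally show "e \<le> \<alpha>" by simp
  have "ln e \<le> ln (\<alpha> * exp (- psi s ?r))"
    using le e \<alpha> by (intro ln_le_cancel_iff[THEN iffD2]) auto
  then have "psi s ?r \<le> ln (\<alpha> / e)"
    using \<alpha> e by (simp add: ln_mult ln_div)
  then show "?r \<le> 2 * ln (\<alpha> / e) + s / 2"
    using psi_ge(1)[OF s euclidean_norm_nonneg, of "A *\<^sub>v x - b"] by linarith
qed

text \<open>A large \<open>\<alpha>\<close> cannot be compensated by a large determinant: the entries of \<open>A\<close> grow at most
  logarithmically in \<open>\<alpha>\<close>.\<close>

lemma feasible_bounded:
  assumes s: "s \<ge> 0" and y: "y \<in> carrier_vec d" and X: "X \<in> carrier_mat d d" "det X \<noteq> 0"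
    and e: "e > 0" "e \<le> f y" "\<And>j. j < d \<Longrightarrow> e \<le> f (col X j + y)"
  obtains C where "\<And>A b \<alpha>. feasible d s f A b \<alpha> \<Longrightarrow> \<alpha> / \<bar>det A\<bar> \<le> J \<Longrightarrow>
    \<bar>\<alpha>\<bar> \<le> C \<and> (\<forall>i<d. \<bar>b $ i\<bar> \<le> C) \<and> (\<forall>i<d. \<forall>j<d. \<bar>A $$ (i, j)\<bar> \<le> C)"
proof -
  define R where "R \<alpha> = 2 * ln (\<alpha> / e) + s / 2" for \<alpha>
  have R0: "0 \<le> R \<alpha>" if "e \<le> \<alpha>" for \<alpha>
    using that e(1) s by (simp add: R_def)
  have entry: "\<bar>(A * X) $$ (i, j)\<bar> \<le> 2 * R \<alpha>" if F: "feasible d s f A b \<alpha>" and ij: "i < d" "j < d" for A b \<alpha> i j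
  proof -
    have A: "A \<in> carrier_mat d d" and b: "b \<in> carrier_vec d"
      using F by (auto simp: feasible_def)
    have c: "col X j \<in> carrier_vec d" using X ij by auto
    have "\<bar>(A *\<^sub>v (col X j + y) - b) $ i\<bar> \<le> R \<alpha>" "\<bar>(A *\<^sub>v y - b) $ i\<bar> \<le> R \<alpha>"
      using abs_index_le_euclidean_norm[of "A *\<^sub>v (col X j + y) - b" d i]
        abs_index_le_euclidean_norm[of "A *\<^sub>v y - b" d i]
        feasible_norm_le(2)[OF F s _ e(1) e(3)[OF ij(2)]] feasible_norm_le(2)[OF F s y e(1,2)] A b c y ij(1)
      unfolding R_def by fastforce+
    \<comment> \<open>Subtracting the values at \<open>col X j + y\<close> and at \<open>y\<close>
      eliminates \<open>b\<close>.\<close>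
    moreover have "(A * X) $$ (i, j) = (A *\<^sub>v (col X j + y) - b) $ i - (A *\<^sub>v y - b) $ i"
      unfolding mult_add_distrib_mat_vec[OF A c y] using A X b c y ij by simp
    ultimately show ?thesis by linarith
  qed
  obtain Y where Y: "Y \<in> carrier_mat d d" "X * Y = 1\<^sub>m d"
    using inverse_matE[OF X] by metis
  \<comment> \<open>\<open>W\<close> transfers the bound from the entries of \<open>A * X\<close> to
    those of \<open>A\<close> through the inverse of \<open>X\<close>; \<open>V\<close> then bounds
    \<open>A *\<^sub>v y\<close> and hence \<open>b\<close>.\<close>
  define W where "W = (\<Sum>k\<in>{0..<d}. \<Sum>j\<in>{0..<d}. \<bar>Y $$ (k, j)\<bar>)"
  define V where "V = (\<Sum>j\<in>{0..<d}. \<bar>y $ j\<bar>)"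
  have W: "W \<ge> 0" and V: "V \<ge> 0" by (auto simp: W_def V_def intro!: sum_nonneg)
  have entryA: "\<bar>A $$ (i, j)\<bar> \<le> 2 * R \<alpha> * W" if F: "feasible d s f A b \<alpha>" and ij: "i < d" "j < d" for A b \<alpha> i j
  proof -
    have A: "A \<in> carrier_mat d d" using F by (auto simp: feasible_def)
    have "A = A * X * Y"
      using A X Y by (simp add: assoc_mult_mat[OF A X(1) Y(1)])
    then have "A $$ (i, j) = (\<Sum>k\<in>{0..<d}. (A * X) $$ (i, k) * Y $$ (k, j))"
      using index_mult_sum[OF mult_carrier_mat[OF A X(1)] Y(1) ij] by simp
    also have "\<bar>\<dots>\<bar> \<le> (\<Sum>k\<in>{0..<d}. 2 * R \<alpha> * \<bar>Y $$ (k, j)\<bar>)"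
      using entry[OF F ij(1)] by (intro order_trans[OF sum_abs] sum_mono) (auto simp: abs_mult intro!: mult_right_mono)
    also have "\<dots> = 2 * R \<alpha> * (\<Sum>k\<in>{0..<d}. \<bar>Y $$ (k, j)\<bar>)"
      by (simp add: sum_distrib_left)
    also have "\<dots> \<le> 2 * R \<alpha> * W"
      unfolding W_def using R0[OF feasible_norm_le(1)[OF F s y e(1,2)]] ij
      by (intro mult_left_mono sum_mono member_le_sum) auto
    finally show ?thesis .
  qed
  have entryb: "\<bar>b $ i\<bar> \<le> 2 * R \<alpha> * W * V + R \<alpha>" if F: "feasible d s f A b \<alpha>" and i: "i < d" for A b \<alpha> i
  proof -
    have A: "A \<in> carrier_mat d d" and b: "b \<in> carrier_vec d" using F by (auto simp: feasible_def)
    have "(A *\<^sub>v y) $ i = (\<Sum>j\<in>{0..<d}. A $$ (i, j) * y $ j)"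
      using A y i by (simp add: scalar_prod_def)
    also have "\<bar>\<dots>\<bar> \<le> (\<Sum>j\<in>{0..<d}. 2 * R \<alpha> * W * \<bar>y $ j\<bar>)"
      using entryA[OF F i] by (intro order_trans[OF sum_abs] sum_mono) (auto simp: abs_mult intro!: mult_right_mono)
    finally have "\<bar>(A *\<^sub>v y) $ i\<bar> \<le> 2 * R \<alpha> * W * V"
      by (simp add: V_def sum_distrib_left)
    moreover have "\<bar>(A *\<^sub>v y - b) $ i\<bar> \<le> R \<alpha>"
      using abs_index_le_euclidean_norm[of "A *\<^sub>v y - b" d i] feasible_norm_le(2)[OF F s y e(1,2)] A b y i
      unfolding R_def by fastforce
    moreover have "(A *\<^sub>v y - b) $ i = (A *\<^sub>v y) $ i - b $ i"
      using A b y i by simp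
    ultimately show ?thesis by linarith
  qed
  \<comment> \<open>By definition of \<open>R\<close>, \<open>\<alpha>\<close> is
    \<open>e * exp (- s / 4) * exp (R \<alpha> / 2)\<close>, whereas
    \<open>\<bar>det A\<bar>\<close> is at most polynomial in \<open>R \<alpha>\<close>.
    \<open>M\<close> gathers the constants so that the bound \<open>J\<close> on the ratio reads
    \<open>exp (R \<alpha> / 2) \<le> M * (R \<alpha> / 2) ^ d\<close>, which fails for large
    \<open>R \<alpha>\<close>.\<close>
  define M where "M = \<bar>J\<bar> * fact d * 4 ^ d / (e * exp (- s / 4) * \<bar>det X\<bar>)"
  have M: "M \<ge> 0" using e by (simp add: M_def)
  have "((\<lambda>x. x ^ d / exp x) \<longlongrightarrow> (0::real)) at_top"
    by (rule tendsto_power_div_exp_0)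
  then have "eventually (\<lambda>x. x ^ d / exp x < 1 / (M + 1)) at_top"
    using M by (intro order_tendstoD(2)) auto
  then obtain r where r: "\<And>x. x \<ge> r \<Longrightarrow> x ^ d / exp x < 1 / (M + 1)"
    unfolding eventually_at_top_linorder by blast
  have R_le: "R \<alpha> \<le> 2 * r" if F: "feasible d s f A b \<alpha>" and J: "\<alpha> / \<bar>det A\<bar> \<le> J" for A b \<alpha>
  proof (rule ccontr)
    assume "\<not> ?thesis"
    then have "(R \<alpha> / 2) ^ d / exp (R \<alpha> / 2) < 1 / (M + 1)"
      by (intro r) simp
    then have small: "(R \<alpha> / 2) ^ d * (M + 1) < exp (R \<alpha> / 2)"
      using M by (simp add: field_simps)
    have A: "A \<in> carrier_mat d d" "det A \<noteq> 0" and \<alpha>: "\<alpha> > 0" using F by (auto simp: feasible_def)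
    have e\<alpha>: "e \<le> \<alpha>" by (rule feasible_norm_le(1)[OF F s y e(1,2)])
    have "\<bar>det A\<bar> * \<bar>det X\<bar> = \<bar>det (A * X)\<bar>"
      using det_mult[OF A(1) X(1)] by (simp add: abs_mult)
    also have "\<dots> \<le> fact d * (2 * R \<alpha>) ^ d"
      using A X entry[OF F] by (intro abs_det_le) auto
    also have "2 * R \<alpha> = 4 * (R \<alpha> / 2)"
      by simp
    also have "fact d * (4 * (R \<alpha> / 2)) ^ d = fact d * 4 ^ d * (R \<alpha> / 2) ^ d"
      by (simp only: power_mult_distrib mult.assoc)
    finally have det: "\<bar>det A\<bar> * \<bar>det X\<bar> \<le> fact d * 4 ^ d * (R \<alpha> / 2) ^ d" .
    have "exp (- s / 4) * exp (R \<alpha> / 2) = exp (ln (\<alpha> / e))"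
      unfolding exp_add[symmetric] by (rule arg_cong[of _ _ exp]) (simp add: R_def add_divide_distrib)
    also have "\<dots> = \<alpha> / e"
      using \<alpha> e(1) by simp
    finally have "\<alpha> = e * exp (- s / 4) * exp (R \<alpha> / 2)"
      using e(1) by (simp add: mult.assoc)
    then have "e * exp (- s / 4) * exp (R \<alpha> / 2) * \<bar>det X\<bar> = \<alpha> * \<bar>det X\<bar>"
      by (simp only:)
    also have "\<dots> \<le> J * \<bar>det A\<bar> * \<bar>det X\<bar>"
      using J A(2) by (intro mult_right_mono) (simp_all add: pos_divide_le_eq)
    also have "\<dots> = J * (\<bar>det A\<bar> * \<bar>det X\<bar>)"
      by (simp only: mult.assoc)
    also have "\<dots> \<le> \<bar>J\<bar> * (fact d * 4 ^ d * (R \<alpha> / 2) ^ d)"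
      by (intro mult_mono det abs_ge_self) simp_all
    also have "\<dots> = M * (e * exp (- s / 4) * \<bar>det X\<bar>) * (R \<alpha> / 2) ^ d"
      using e(1) X(2) by (simp add: M_def)
    finally have "(e * exp (- s / 4) * \<bar>det X\<bar>) * exp (R \<alpha> / 2) \<le> (e * exp (- s / 4) * \<bar>det X\<bar>) * ((R \<alpha> / 2) ^ d * M)"
      by (simp only: ac_simps)
    then have "exp (R \<alpha> / 2) \<le> (R \<alpha> / 2) ^ d * M"
      using e(1) X(2) by (subst (asm) mult_le_cancel_left_pos) auto
    moreover have "0 \<le> (R \<alpha> / 2) ^ d"
      using R0[OF e\<alpha>] by simp
    ultimately show False
      using small by (simp add: algebra_simps)
  qed
  define Q where "Q = \<bar>2 * r\<bar>"
  define C where "C = e * exp Q + (2 * Q * W * V + Q) + 2 * Q * W"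
  show thesis
  proof (rule that[of C])
    fix A b \<alpha> assume F: "feasible d s f A b \<alpha>" and J: "\<alpha> / \<bar>det A\<bar> \<le> J"
    have e\<alpha>: "e \<le> \<alpha>" by (rule feasible_norm_le(1)[OF F s y e(1,2)])
    have Q: "0 \<le> Q" "R \<alpha> \<le> Q" using R_le[OF F J] by (auto simp: Q_def)
    have "ln (\<alpha> / e) \<le> Q"
    proof -
      have "0 \<le> ln (\<alpha> / e)"
        using e\<alpha> e(1) by simp
      then show ?thesis
        using Q(2) s by (simp add: R_def)
    qed
    then have "\<alpha> / e \<le> exp Q"
    proof -
      have "0 < \<alpha> / e" using e\<alpha> e(1) by simp
      then show ?thesis using \<open>ln (\<alpha> / e) \<le> Q\<close> by (metis exp_le_cancel_iff exp_ln)
    qed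
    then have "\<bar>\<alpha>\<bar> \<le> e * exp Q"
      using e\<alpha> e(1) by (simp add: field_simps)
    moreover have "2 * R \<alpha> * W \<le> 2 * Q * W" using Q W by (intro mult_right_mono) auto
    moreover have "2 * R \<alpha> * W * V \<le> 2 * Q * W * V" using Q W V by (intro mult_right_mono) auto
    moreover have "0 \<le> e * exp Q" "0 \<le> 2 * Q * W" "0 \<le> 2 * Q * W * V"
      using e Q W V by auto
    ultimately have C: "\<bar>\<alpha>\<bar> \<le> C" "2 * R \<alpha> * W * V + R \<alpha> \<le> C" "2 * R \<alpha> * W \<le> C"
      using Q unfolding C_def by linarith+
    show "\<bar>\<alpha>\<bar> \<le> C \<and> (\<forall>i<d. \<bar>b $ i\<bar> \<le> C) \<and> (\<forall>i<d. \<forall>j<d. \<bar>A $$ (i, j)\<bar> \<le> C)"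
      using C(1) order_trans[OF entryb[OF F] C(2)] order_trans[OF entryA[OF F] C(3)] by blast
  qed
qed

text \<open>The direct method: a minimizing sequence has bounded parameters, and a subsequence
  converges. The limit is admissible because neither \<open>\<alpha>\<close> nor the determinant can
  tend to 0, and the majorization passes to the limit pointwise by continuity of
  \<open>psi\<close>.\<close>

lemma minimizer_exists:
  assumes s: "s \<ge> 0" and y: "y \<in> carrier_vec d" and X: "X \<in> carrier_mat d d" "det X \<noteq> 0"
    and e: "e > 0" "e \<le> f y" "\<And>j. j < d \<Longrightarrow> e \<le> f (col X j + y)"
    and F0: "feasible d s f A0 b0 \<alpha>0"
  obtains A b \<alpha> where "feasible d s f A b \<alpha>"
    "\<And>A' b' \<alpha>'. feasible d s f A' b' \<alpha>' \<Longrightarrow> \<alpha> / \<bar>det A\<bar> \<le> \<alpha>' / \<bar>det A'\<bar>"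
proof -
  define S where "S = {v. \<exists>A b \<alpha>. feasible d s f A b \<alpha> \<and> v = \<alpha> / \<bar>det A\<bar>}"
  have S_nonneg: "0 \<le> v" if v: "v \<in> S" for v
    using v by (auto simp: S_def feasible_def)
  then have bdd: "bdd_below S" by (rule bdd_belowI)
  have ne: "S \<noteq> {}" using F0 by (auto simp: S_def)
  define m where "m = Inf S"
  have "\<exists>A b \<alpha>. feasible d s f A b \<alpha> \<and> \<alpha> / \<bar>det A\<bar> < m + 1 / real (Suc n)" for n
  proof -
    have "\<exists>v\<in>S. v < m + 1 / real (Suc n)"
      using ne bdd by (subst cInf_less_iff[symmetric]) (auto simp: m_def)
    then show ?thesis by (auto simp: S_def)
  qed
  then obtain An bn an where F: "\<And>n. feasible d s f (An n) (bn n) (an n)"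
    and lt: "\<And>n. an n / \<bar>det (An n)\<bar> < m + 1 / real (Suc n)"
    by metis
  have lt1: "an n / \<bar>det (An n)\<bar> \<le> m + 1" for n
  proof -
    have "1 / real (Suc n) \<le> 1" by simp
    then show ?thesis using lt[of n] by linarith
  qed
  have m_le: "m \<le> \<alpha> / \<bar>det A\<bar>" if F: "feasible d s f A b \<alpha>" for A b \<alpha>
    unfolding m_def by (rule cInf_lower[OF _ bdd]) (use F in \<open>auto simp: S_def\<close>)
  obtain C where C: "\<And>A b \<alpha>. feasible d s f A b \<alpha> \<Longrightarrow> \<alpha> / \<bar>det A\<bar> \<le> m + 1 \<Longrightarrow>
      \<bar>\<alpha>\<bar> \<le> C \<and> (\<forall>i<d. \<bar>b $ i\<bar> \<le> C) \<and> (\<forall>i<d. \<forall>j<d. \<bar>A $$ (i, j)\<bar> \<le> C)"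
    using feasible_bounded[OF s y X e] by metis
  \<comment> \<open>All parameters are packed into one square array of size \<open>d + 1\<close>:
    \<open>A\<close> in the leading block, \<open>b\<close> in the last column,
    \<open>\<alpha>\<close> throughout the last row.\<close>
  define h where "h n = (\<lambda>(i, j). if i < d then if j < d then An n $$ (i, j) else bn n $ i else an n)" for n
  have "\<bar>h n p\<bar> \<le> C" for n p
    using C[OF F[of n] lt1[of n]] by (simp add: h_def split: prod.split)
  then obtain r :: "nat \<Rightarrow> nat" and l where r: "strict_mono r"
    and l: "\<forall>p\<in>{..d} \<times> {..d}. (\<lambda>n. h (r n) p) \<longlonglongrightarrow> l p"
    using convergent_subsequence_finite[of "{..d} \<times> {..d}" h C] by auto
  define A where "A = mat d d l"
  define b where "b = vec d (\<lambda>i. l (i, d))"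
  define a where "a = l (d, d)"
  have A: "A \<in> carrier_mat d d" and b: "b \<in> carrier_vec d"
    by (simp_all add: A_def b_def)
  have An: "An n \<in> carrier_mat d d" "bn n \<in> carrier_vec d" "det (An n) \<noteq> 0" "an n > 0" for n
    using F[of n] by (simp_all add: feasible_def)
  have limA: "(\<lambda>n. An (r n) $$ (i, j)) \<longlonglongrightarrow> A $$ (i, j)" if ij: "i < d" "j < d" for i j
    using l[rule_format, of "(i, j)"] ij by (simp add: h_def A_def)
  have limb: "(\<lambda>n. bn (r n) $ i) \<longlonglongrightarrow> b $ i" if i: "i < d" for i
    using l[rule_format, of "(i, d)"] i by (simp add: h_def b_def)
  have lima: "(\<lambda>n. an (r n)) \<longlonglongrightarrow> a"
    using l[rule_format, of "(d, d)"] by (simp add: h_def a_def)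
  have limdet: "(\<lambda>n. \<bar>det (An (r n))\<bar>) \<longlonglongrightarrow> \<bar>det A\<bar>"
    by (intro tendsto_rabs tendsto_det[OF An(1) A limA])
  have e_le: "e \<le> an n" for n
    by (rule feasible_norm_le(1)[OF F s y e(1,2)])
  then have a: "e \<le> a"
    using lima by (intro LIMSEQ_le_const) auto
  have m0: "m \<ge> 0"
    unfolding m_def using ne S_nonneg by (intro cInf_greatest) auto
  \<comment> \<open>The ratio is at most \<open>m + 1\<close> along the sequence and its numerator
    at least \<open>e\<close>, which keeps the determinant away from 0.\<close>
  have det_ge: "e / (m + 1) \<le> \<bar>det (An n)\<bar>" for n
  proof -
    have "e \<le> (m + 1) * \<bar>det (An n)\<bar>"
      using lt1[of n] e_le[of n] An(3)[of n] by (simp add: pos_divide_le_eq)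
    then show ?thesis
      using m0 by (simp add: pos_divide_le_eq mult.commute)
  qed
  have "e / (m + 1) \<le> \<bar>det A\<bar>"
    using limdet det_ge by (intro LIMSEQ_le_const) auto
  moreover have "0 < e / (m + 1)" using e m0 by simp
  ultimately have detA: "det A \<noteq> 0" by auto
  have "f x \<le> a * exp (- psi s (euclidean_norm (A *\<^sub>v x - b)))" if x: "x \<in> carrier_vec d" for x
  proof (rule LIMSEQ_le_const)
    have coord: "(B *\<^sub>v x - c) $ i = (\<Sum>j\<in>{0..<d}. B $$ (i, j) * x $ j) - c $ i"
      if "B \<in> carrier_mat d d" "c \<in> carrier_vec d" "i < d" for B c i
      using that x by (simp add: scalar_prod_def)
    have norm: "euclidean_norm (B *\<^sub>v x - c) = sqrt (\<Sum>i<d. ((\<Sum>j\<in>{0..<d}. B $$ (i, j) * x $ j) - c $ i)\<^sup>2)"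
      if B: "B \<in> carrier_mat d d" "c \<in> carrier_vec d" for B c
    proof -
      have "B *\<^sub>v x - c \<in> carrier_vec d" using B x by simp
      then show ?thesis
        using coord[OF B] by (simp add: euclidean_norm_eq)
    qed
    have "(\<lambda>n. euclidean_norm (An (r n) *\<^sub>v x - bn (r n))) \<longlonglongrightarrow> euclidean_norm (A *\<^sub>v x - b)"
      unfolding norm[OF An(1,2)] norm[OF A b]
      by (intro tendsto_real_sqrt tendsto_sum tendsto_power tendsto_diff tendsto_mult tendsto_const limA limb) auto
    then have "(\<lambda>n. psi s (euclidean_norm (An (r n) *\<^sub>v x - bn (r n)))) \<longlonglongrightarrow> psi s (euclidean_norm (A *\<^sub>v x - b))"
      by (rule isCont_tendsto_compose[OF isCont_psi])
    then show "(\<lambda>n. an (r n) * exp (- psi s (euclidean_norm (An (r n) *\<^sub>v x - bn (r n)))))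
        \<longlonglongrightarrow> a * exp (- psi s (euclidean_norm (A *\<^sub>v x - b)))"
      by (intro tendsto_mult tendsto_exp tendsto_minus lima)
    show "\<exists>N. \<forall>n\<ge>N. f x \<le> an (r n) * exp (- psi s (euclidean_norm (An (r n) *\<^sub>v x - bn (r n))))"
      using F x by (simp add: feasible_def)
  qed
  then have feas: "feasible d s f A b a"
    using A b detA a e(1) by (simp add: feasible_def)
  have "(\<lambda>n. an (r n) / \<bar>det (An (r n))\<bar>) \<longlonglongrightarrow> a / \<bar>det A\<bar>"
    using detA by (intro tendsto_divide lima limdet) simp
  moreover have "(\<lambda>n. m + 1 / real (Suc (r n))) \<longlonglongrightarrow> m + 0"
    using LIMSEQ_subseq_LIMSEQ[OF LIMSEQ_inverse_real_of_nat r]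
    by (intro tendsto_add tendsto_const) (simp add: o_def inverse_eq_divide)
  ultimately have "a / \<bar>det A\<bar> \<le> m + 0"
    by (rule LIMSEQ_le) (use lt in \<open>auto intro: less_imp_le\<close>)
  then have "a / \<bar>det A\<bar> \<le> m"
    by simp
  from that[OF feas order_trans[OF this m_le]] show thesis .
qed

lemma ellipsoidal_integral:
  assumes A: "A \<in> carrier_mat d d" "det A \<noteq> 0" and a: "a \<in> carrier_vec d" and \<alpha>: "\<alpha> > 0"
    and g: "\<And>x. x \<in> carrier_vec d \<Longrightarrow> g x = \<alpha> * exp (- psi s (euclidean_norm (A *\<^sub>v (x - a))))"
  shows "integral\<^sup>L (lborel_vec d) g = \<alpha> / \<bar>det A\<bar> * psi_mass d s"
proof -
  have "integral\<^sup>L (lborel_vec d) g = (\<integral>x. \<alpha> * exp (- psi s (euclidean_norm (A *\<^sub>v x - A *\<^sub>v a))) \<partial>lborel_vec d)"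
    using A a by (intro Bochner_Integration.integral_cong[OF refl]) (simp add: g mult_minus_distrib_mat_vec)
  then show ?thesis
    using integral_ellipsoidal[OF A _ \<alpha>, of "A *\<^sub>v a" s] A a by simp
qed

text \<open>All integrals are the ratio \<open>\<alpha> / \<bar>det A\<bar>\<close> times the common
  factor \<open>psi_mass d s\<close>, so a minimizer of the ratio is a Loewner function; once one
  exists, \<open>SOME\<close> selects one.\<close>

lemma is_loewner_function_loewner_function:
  assumes s: "s \<ge> 0" and y: "y \<in> carrier_vec d" and X: "X \<in> carrier_mat d d" "det X \<noteq> 0"
    and e: "e > 0" "e \<le> f y" "\<And>j. j < d \<Longrightarrow> e \<le> f (col X j + y)"
    and F0: "feasible d s f A0 b0 \<alpha>0"
  shows "is_loewner_function d s f (loewner_function d s f)"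
proof -
  obtain A b \<alpha> where F: "feasible d s f A b \<alpha>"
    and min: "\<And>A' b' \<alpha>'. feasible d s f A' b' \<alpha>' \<Longrightarrow> \<alpha> / \<bar>det A\<bar> \<le> \<alpha>' / \<bar>det A'\<bar>"
    using minimizer_exists[OF s y X e F0] by metis
  have A: "A \<in> carrier_mat d d" "det A \<noteq> 0" and b: "b \<in> carrier_vec d" and \<alpha>: "\<alpha> > 0"
    using F by (auto simp: feasible_def)
  obtain B where B: "B \<in> carrier_mat d d" "A * B = 1\<^sub>m d"
    using inverse_matE[OF A] by metis
  define a where "a = B *\<^sub>v b"
  have a: "a \<in> carrier_vec d" "A *\<^sub>v a = b"
    using A B b by (simp_all add: a_def flip: assoc_mult_mat_vec)
  define g where "g x = \<alpha> * exp (- psi s (euclidean_norm (A *\<^sub>v (x - a))))" for x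
  have diff: "A *\<^sub>v (x - a) = A *\<^sub>v x - b" if "x \<in> carrier_vec d" for x
    using A a that by (simp add: mult_minus_distrib_mat_vec)
  have mass: "0 \<le> psi_mass d s" by (simp add: psi_mass_def)
  have "is_loewner_function d s f g"
    unfolding is_loewner_function_def is_arg_min_linorder
  proof (intro conjI allI impI)
    show "g \<in> ellipsoidal_functions d (psi s)"
      unfolding ellipsoidal_functions_def g_def using A a \<alpha> invertible_mat_iff_det[OF A(1)] by blast
    show "\<forall>x\<in>carrier_vec d. f x \<le> g x"
      using F by (simp add: feasible_def g_def diff)
    fix g' assume g': "g' \<in> ellipsoidal_functions d (psi s) \<and> (\<forall>x\<in>carrier_vec d. f x \<le> g' x)"
    then obtain A' \<alpha>' a' where A': "A' \<in> carrier_mat d d" "det A' \<noteq> 0" and \<alpha>': "\<alpha>' > 0"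
      and a': "a' \<in> carrier_vec d"
      and eq: "\<And>x. x \<in> carrier_vec d \<Longrightarrow> g' x = \<alpha>' * exp (- psi s (euclidean_norm (A' *\<^sub>v (x - a'))))"
      unfolding ellipsoidal_functions_def using invertible_mat_iff_det by blast
    have "feasible d s f A' (A' *\<^sub>v a') \<alpha>'"
      using g' A' a' \<alpha>' eq unfolding feasible_def by (simp add: mult_minus_distrib_mat_vec)
    then have "\<alpha> / \<bar>det A\<bar> * psi_mass d s \<le> \<alpha>' / \<bar>det A'\<bar> * psi_mass d s"
      using mass by (intro mult_right_mono min)
    then show "integral\<^sup>L (lborel_vec d) g \<le> integral\<^sup>L (lborel_vec d) g'"
      using ellipsoidal_integral[OF A a(1) \<alpha>, of g s] ellipsoidal_integral[OF A' a' \<alpha>' eq] by (simp add: g_def)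
  qed
  then show ?thesis
    unfolding loewner_function_def by (rule someI[of "is_loewner_function d s f"])
qed

section \<open>The integral ratio of the Loewner function\<close>

theorem theorem1p5:
  fixes s :: real
  assumes "s \<ge> 0"
  shows "\<exists>\<Theta>::real. \<forall>d::nat. d \<ge> 1 \<longrightarrow>
    (\<forall>f :: real Matrix.vec \<Rightarrow> real.
       (\<forall>x\<in>carrier_vec d. f x \<ge> 0) \<longrightarrow>
       log_concave d f \<longrightarrow>
       upper_semicontinuous d f \<longrightarrow>
       integrable (lborel_vec d) f \<longrightarrow>
       integral\<^sup>L (lborel_vec d) f > 0 \<longrightarrow>
       (integral\<^sup>L (lborel_vec d) (loewner_function d s f) / integral\<^sup>L (lborel_vec d) f)
         powr (1 / real d) \<le> \<Theta> * sqrt (real d))"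
proof (intro exI[of _ "16 * exp (5 + s / 4)"] allI impI)
  fix d :: nat and f :: "real Matrix.vec \<Rightarrow> real"
  assume d: "d \<ge> 1" and nonneg: "\<forall>x\<in>carrier_vec d. f x \<ge> 0" and "log_concave d f"
    and int: "integrable (lborel_vec d) f" and pos: "integral\<^sup>L (lborel_vec d) f > 0"
  define I where "I = integral\<^sup>L (lborel_vec d) f"
  have I: "I > 0" using pos by (simp add: I_def)
  have fm: "f \<in> borel_measurable (lborel_vec d)"
    using int by (rule borel_measurable_integrable)
  have f: "powr_concave d f"
    by (rule log_concave_imp_powr_concave) fact
  have nnI: "(\<integral>\<^sup>+x. ennreal (f x) \<partial>lborel_vec d) = ennreal I"
    unfolding I_def by (rule nn_integral_eq_integral[OF int]) (use nonneg in auto)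
  have nnpos: "(\<integral>\<^sup>+x. ennreal (f x) \<partial>lborel_vec d) > 0"
    using I by (simp add: nnI)
  obtain y X e where simplex: "y \<in> carrier_vec d" "X \<in> carrier_mat d d" "det X \<noteq> 0" "e > 0" "e \<le> f y"
      "\<And>j. j < d \<Longrightarrow> e \<le> f (col X j + y)"
    using support_simplex[OF f fm nnpos] by metis
  obtain A \<alpha> a where A: "A \<in> carrier_mat d d" "det A \<noteq> 0" and a: "a \<in> carrier_vec d" and \<alpha>: "\<alpha> > 0"
    and le: "\<And>x. x \<in> carrier_vec d \<Longrightarrow> f x \<le> \<alpha> * exp (- euclidean_norm (A *\<^sub>v (x - a)))"
    and vol: "\<alpha> / \<bar>det A\<bar> \<le> (4 * exp 5) ^ d * I"
    using exponential_majorant[OF d f fm nnI I] by metis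
  \<comment> \<open>Since \<open>psi s t \<le> t\<close>, replacing the exponential profile by that
    of \<open>psi\<close> only enlarges the majorant, with the same matrix, centre and
    height.\<close>
  define g where "g x = \<alpha> * exp (- psi s (euclidean_norm (A *\<^sub>v (x - a))))" for x
  have fg: "f x \<le> g x" if x: "x \<in> carrier_vec d" for x
  proof -
    have "\<alpha> * exp (- euclidean_norm (A *\<^sub>v (x - a))) \<le> g x"
      unfolding g_def using \<alpha> psi_le[OF assms euclidean_norm_nonneg] by (intro mult_left_mono) auto
    then show ?thesis using le[OF x] by linarith
  qed
  have feas: "feasible d s f A (A *\<^sub>v a) \<alpha>"
    using A a \<alpha> fg by (simp add: feasible_def g_def mult_minus_distrib_mat_vec)
  have L: "is_loewner_function d s f (loewner_function d s f)"
    by (rule is_loewner_function_loewner_function[OF assms simplex feas])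
  have g: "g \<in> ellipsoidal_functions d (psi s)"
    unfolding ellipsoidal_functions_def g_def using A a \<alpha> invertible_mat_iff_det[OF A(1)] by blast
  have "integral\<^sup>L (lborel_vec d) (loewner_function d s f) \<le> integral\<^sup>L (lborel_vec d) g"
    using L g fg unfolding is_loewner_function_def is_arg_min_linorder by blast
  also have "\<dots> = \<alpha> / \<bar>det A\<bar> * psi_mass d s"
    by (rule ellipsoidal_integral[OF A a \<alpha>]) (simp add: g_def)
  \<comment> \<open>The majorant contributes \<open>4 * exp 5\<close> per dimension and the mass of
    the profile another \<open>4 * sqrt d\<close>; together they give the constant 16.\<close>
  also have "\<dots> \<le> ((4 * exp 5) ^ d * I) * (exp (s / 4) * (4 * sqrt (real d)) ^ d)"
    using vol psi_mass_le[OF d assms] \<alpha> I by (intro mult_mono) (auto simp: psi_mass_def)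
  \<comment> \<open>The single factor \<open>exp (s / 4)\<close> is raised to the power
    \<open>d\<close>, so that the root leaves a constant depending only on \<open>s\<close>.\<close>
  also have "\<dots> \<le> ((4 * exp 5) ^ d * I) * (exp (s / 4) ^ d * (4 * sqrt (real d)) ^ d)"
    using assms d I by (intro mult_left_mono mult_right_mono self_le_power) auto
  also have "\<dots> = (16 * exp (5 + s / 4) * sqrt (real d)) ^ d * I"
    by (simp add: exp_add power_mult_distrib flip: power_mult_distrib[of 4 4])
  finally have "integral\<^sup>L (lborel_vec d) (loewner_function d s f) / I \<le> (16 * exp (5 + s / 4) * sqrt (real d)) ^ d"
    using I by (simp add: pos_divide_le_eq)
  \<comment> \<open>Monotonicity of \<open>powr\<close> needs a nonnegative base; it comes from the
    majorization of the nonnegative \<open>f\<close>.\<close>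
  moreover have "0 \<le> integral\<^sup>L (lborel_vec d) (loewner_function d s f) / I"
  proof -
    have "0 \<le> integral\<^sup>L (lborel_vec d) (loewner_function d s f)"
    proof (rule integral_nonneg_AE, rule AE_I2)
      fix x assume "x \<in> space (lborel_vec d)"
      then have x: "x \<in> carrier_vec d" by simp
      have "f x \<le> loewner_function d s f x"
        using L x unfolding is_loewner_function_def is_arg_min_linorder by blast
      then show "0 \<le> loewner_function d s f x"
        using nonneg x by force
    qed
    then show ?thesis using I by simp
  qed
  ultimately have "(integral\<^sup>L (lborel_vec d) (loewner_function d s f) / I) powr (1 / real d)
      \<le> ((16 * exp (5 + s / 4) * sqrt (real d)) ^ d) powr (1 / real d)"
    by (intro powr_mono2) auto
  also have "\<dots> = 16 * exp (5 + s / 4) * sqrt (real d)"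
    using d by (simp add: powr_realpow[symmetric] powr_powr)
  finally show "(integral\<^sup>L (lborel_vec d) (loewner_function d s f) / integral\<^sup>L (lborel_vec d) f)
      powr (1 / real d) \<le> 16 * exp (5 + s / 4) * sqrt (real d)"
    by (simp add: I_def)
qed

end
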